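(* Let $H>0$ and $S_H=\{z\in\mathbb{C}:\,|\operatorname{Im} z|\le H\}$. Let $\mu$ be a measure with support in $S_H$ which is either (a) positive and satisfies $\mu(\{z\in S_H:\,|\operatorname{Re} z|\le r\})\le C_0\max\{1,r^\rho\}$ for all $r>0$ with some positive constants $C_0,\rho$, or (b) a complex measure that is translation bounded on $S_H$, i.e. $\sup_{s\in\mathbb{R}}|\mu|(\{z\in S_H:\,s\le\operatorname{Re} z\le s+1\})<\infty$. Suppose that the c-Fourier transform of $\mu$ is a pure point measure $\hat\mu^c=\sum_{\gamma\in\Gamma}b_\gamma\delta_\gamma$, and that there exists $\eta>0$ such that for every $t\in\mathbb{R}$ the set $\Gamma\cap(t-\eta,t+\eta)$ is linearly independent over $\mathbb{Z}$. Then $$|\hat\mu^c|(t-1,t+1)=O(e^{2\pi H|t|})\quad\text{as } t\to\infty,$$ and $\hat\mu^c$ has type at most $2\pi H$ with respect to exponential growth, i.e. $\limsup_{r\to\infty}r^{-1}\log|\hat\mu^c|(-r,r)\le 2\pi H$.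
   Context: $|\sigma|$ denotes the variation of a complex measure $\sigma$. For $\varphi\in L^1(\mathbb{R})$ with compact support, $\hat\varphi^c(z)=\int_{\mathbb{R}}\varphi(t)e^{-2\pi i z t}\,dt$, $z\in\mathbb{C}$. Let $\mathcal{D}$ be the space of $C^\infty$ compactly supported functions on $\mathbb{R}$. For a measure $\mu$ on $S_H$ with $|\mu|(\{z\in S_H:|\operatorname{Re} z|\le r\})\le C\max\{1,r^\rho\}$ (which holds for translation bounded measures with $\rho=1$), the c-Fourier transform $\hat\mu^c$ is the functional on $\mathcal{D}$ given by $(\hat\mu^c,\varphi)=\int_{S_H}\hat\varphi^c(z)\,\mu(dz)$. "$\hat\mu^c$ is a pure point measure $\sum_{\gamma\in\Gamma}b_\gamma\delta_\gamma$" means $\Gamma\subset\mathbb{R}$ is countable, $b_\gamma\in\mathbb{C}$, $\sum_{\gamma\in\Gamma\cap K}|b_\gamma|<\infty$ for every compact $K$, and $(\hat\mu^c,\varphi)=\sum_\gamma b_\gamma\varphi(\gamma)$ for all $\varphi\in\mathcal{D}$; $\delta_\gamma$ is the unit mass at $\gamma$. A set $X\subset\mathbb{R}$ is linearly independent over $\mathbb{Z}$ if for any distinct $t_1,\dots,t_n\in X$ and $m_1,\dots,m_n\in\mathbb{Z}$, $m_1t_1+\dots+m_nt_n=0$ implies $m_1=\dots=m_n=0$. *)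

theory Defs
  imports "HOL-Analysis.Analysis" "HOL-Library.Landau_Symbols"
begin

definition strip :: "real \<Rightarrow> complex set" where
  "strip H = {z. \<bar>Im z\<bar> \<le> H}"

definition test_fun :: "(real \<Rightarrow> complex) \<Rightarrow> bool" where
  "test_fun \<phi> \<longleftrightarrow>
     (\<exists>D :: nat \<Rightarrow> real \<Rightarrow> complex. D 0 = \<phi> \<and>
        (\<forall>n x. (D n has_vector_derivative D (Suc n) x) (at x))) \<and>
     compact (closure {t. \<phi> t \<noteq> 0})"

definition cfourier :: "(real \<Rightarrow> complex) \<Rightarrow> complex \<Rightarrow> complex" where
  "cfourier \<phi> z = (LINT t|lborel. \<phi> t * exp (- (2 * pi * \<i>) * z * complex_of_real t))"

text \<open>A complex measure \<mu> on the complex plane is represented by its polar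
  decomposition: its variation |\<mu>| = \<nu> (a positive Borel measure) and a
  density f with |f| = 1 \<nu>-a.e., so that \<mu>(dz) = f(z) \<nu>(dz).
  The c-Fourier transform of \<mu> applied to a test function \<phi>:\<close>
definition cFT_meas :: "complex measure \<Rightarrow> (complex \<Rightarrow> complex) \<Rightarrow> (real \<Rightarrow> complex) \<Rightarrow> complex" where
  "cFT_meas \<nu> f \<phi> = (LINT z|\<nu>. cfourier \<phi> z * f z)"

definition lin_indep_int :: "real set \<Rightarrow> bool" where
  "lin_indep_int X \<longleftrightarrow>
     (\<forall>F (m :: real \<Rightarrow> int). finite F \<and> F \<subseteq> X \<and> (\<Sum>t\<in>F. of_int (m t) * t) = 0
        \<longrightarrow> (\<forall>t\<in>F. m t = 0))"

definition cFT_pure_point ::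
  "complex measure \<Rightarrow> (complex \<Rightarrow> complex) \<Rightarrow> real set \<Rightarrow> (real \<Rightarrow> complex) \<Rightarrow> bool" where
  "cFT_pure_point \<nu> f \<Gamma> b \<longleftrightarrow>
     countable \<Gamma> \<and>
     (\<forall>K. compact K \<longrightarrow> (\<lambda>\<gamma>. norm (b \<gamma>)) summable_on (\<Gamma> \<inter> K)) \<and>
     (\<forall>\<phi>. test_fun \<phi> \<longrightarrow> cFT_meas \<nu> f \<phi> = (\<Sum>\<^sub>\<infinity>\<gamma>\<in>\<Gamma>. b \<gamma> * \<phi> \<gamma>))"

definition pp_var :: "real set \<Rightarrow> (real \<Rightarrow> complex) \<Rightarrow> real set \<Rightarrow> real" where
  "pp_var \<Gamma> b A = (\<Sum>\<^sub>\<infinity>\<gamma>\<in>\<Gamma> \<inter> A. norm (b \<gamma>))"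

end

(*
Test the identity of the measure with its c-Fourier transform against phi(x - t) exp(2 pi i s x),
where phi is a smooth bump supported in (-eta, eta).  On the transform side this gives the absolutely
convergent series sum_g b_g phi(g - t) exp(2 pi i s g); on the measure side it is bounded by
C exp(2 pi H |t|) uniformly in s, because the transform of phi decays fast on the strip and mu is
translation bounded.  The frequencies involved are independent over Z, so by Kronecker's theorem
the supremum over s of the modulus of the series is sum_g |b_g| phi(g - t).

A positive measure of polynomial growth is translation bounded for the following reason.  Let psi be
chi * chi with chi an even real bump, so that its transform is nonnegative on the real axis.  Rescaled
to width L, the transform of psi has real part at least c on a window of length 2L and its negative
part on the strip is O(1/L) times a rapidly decaying weight.  Hence the masses h(s) of the windows
satisfy h(s) <= A + (average of h around s) / 2 once L is large, and iterating this inequality from the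
polynomial a priori bound gives h <= 2A.
*)
theory Submission
  imports Defs "HOL-Real_Asymp.Real_Asymp"
begin

section \<open>Smooth functions and bumps\<close>

text \<open>The rate 2 pi H has one source: translating a test function by t multiplies its
  transform by exp(-2 pi i z t), of modulus exp(2 pi t Im z). Modulation by s only slides the
  transform along the real axis and changes no modulus on the pure point side. The obstacle in the
  positive case is that the square of the transform of chi is known to be nonnegative only on the
  real line, while the measure lives on a strip. Its values at z and Re z differ by O(|Im z|) times
  a decaying factor, and a dilation by L replaces Im z by Im z / L. Masses have to be measured in
  windows of the same width L: in unit windows, the number of windows met by the dilated kernel
  would eat up the factor 1/L. Independence is assumed only in windows of radius eta, so the
  variation is first bounded on short intervals and then, by covering, on (t - 1, t + 1) and (-r,
  r). The number of intervals is linear in r and disappears in the type.\<close>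

definition smooth_fun :: "(real \<Rightarrow> complex) \<Rightarrow> bool" where
  "smooth_fun g \<longleftrightarrow> (\<exists>D :: nat \<Rightarrow> real \<Rightarrow> complex. D 0 = g \<and>
     (\<forall>n x. (D n has_vector_derivative D (Suc n) x) (at x)))"

lemma test_fun_iff: "test_fun g \<longleftrightarrow> smooth_fun g \<and> compact (closure {t. g t \<noteq> 0})"
  by (simp add: test_fun_def smooth_fun_def)

text \<open>Any class of functions closed under differentiation consists of smooth functions: choose
  one derivative inside the class and iterate. Every smoothness proof below only has to exhibit such
  a class.\<close>

lemma smooth_fun_coinduct:
  assumes "P g"
    and step: "\<And>h. P h \<Longrightarrow> \<exists>h'. P h' \<and> (\<forall>x. (h has_vector_derivative h' x) (at x))"
  shows "smooth_fun g"
proof -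
  obtain d where d: "\<And>h. P h \<Longrightarrow> P (d h) \<and> (\<forall>x. (h has_vector_derivative d h x) (at x))"
    using step by metis
  have "P ((d ^^ n) g)" for n
    by (induction n) (use assms(1) d in auto)
  then show ?thesis
    unfolding smooth_fun_def using d by (intro exI[of _ "\<lambda>n. (d ^^ n) g"]) auto
qed

lemma smooth_fun_derivE:
  assumes "smooth_fun g"
  obtains g' where "smooth_fun g'" "\<And>x. (g has_vector_derivative g' x) (at x)"
proof -
  obtain D where D: "D 0 = g" "\<And>n x. (D n has_vector_derivative D (Suc n) x) (at x)"
    using assms unfolding smooth_fun_def by blast
  have "smooth_fun (D 1)"
    unfolding smooth_fun_def using D(2) by (intro exI[of _ "\<lambda>n. D (Suc n)"]) auto
  moreover have "(g has_vector_derivative D 1 x) (at x)" for x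
    using D(2)[of 0 x] D(1) by simp
  ultimately show thesis using that by blast
qed

lemma smooth_fun_continuous: "smooth_fun g \<Longrightarrow> continuous_on A g"
  by (metis continuous_at_imp_continuous_on has_vector_derivative_continuous smooth_fun_derivE)

text \<open>Products alone are not closed under differentiation; the Leibniz rule leads to finite
  sums of products, which are.\<close>

inductive sum_of_products :: "(real \<Rightarrow> complex) \<Rightarrow> bool" where
  "smooth_fun g \<Longrightarrow> smooth_fun h \<Longrightarrow> sum_of_products (\<lambda>x. g x * h x)"
| "sum_of_products g \<Longrightarrow> sum_of_products h \<Longrightarrow> sum_of_products (\<lambda>x. g x + h x)"

lemma smooth_fun_mult:
  assumes "smooth_fun g" "smooth_fun h"
  shows "smooth_fun (\<lambda>x. g x * h x)"
proof (rule smooth_fun_coinduct[of sum_of_products])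
  show "sum_of_products (\<lambda>x. g x * h x)"
    using assms by (rule sum_of_products.intros)
  fix k assume "sum_of_products k"
  then show "\<exists>k'. sum_of_products k' \<and> (\<forall>x. (k has_vector_derivative k' x) (at x))"
  proof induction
    case (1 g h)
    obtain g' h' where "smooth_fun g'" "\<And>x. (g has_vector_derivative g' x) (at x)"
      "smooth_fun h'" "\<And>x. (h has_vector_derivative h' x) (at x)"
      using 1 by (meson smooth_fun_derivE)
    then show ?case
      using 1 by (intro exI[of _ "\<lambda>x. g x * h' x + g' x * h x"])
        (auto intro!: sum_of_products.intros has_vector_derivative_mult)
  next
    case (2 g h)
    then obtain g' h' where "sum_of_products g'" "\<And>x. (g has_vector_derivative g' x) (at x)"
      "sum_of_products h'" "\<And>x. (h has_vector_derivative h' x) (at x)"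
      by metis
    then show ?case
      by (intro exI[of _ "\<lambda>x. g' x + h' x"])
        (auto intro!: sum_of_products.intros has_vector_derivative_add)
  qed
qed

lemma has_vector_derivative_exp_mult:
  "((\<lambda>x. exp (a * complex_of_real x)) has_vector_derivative a * exp (a * complex_of_real x)) (at x)"
  by (rule derivative_eq_intros has_vector_derivative_real_field | simp)+

lemma smooth_fun_exp: "smooth_fun (\<lambda>x. c * exp (a * complex_of_real x))"
proof (rule smooth_fun_coinduct[of "\<lambda>g. \<exists>c. g = (\<lambda>x. c * exp (a * complex_of_real x))"])
  fix h assume "\<exists>c. h = (\<lambda>x. c * exp (a * complex_of_real x))"
  then obtain c where h: "h = (\<lambda>x. c * exp (a * complex_of_real x))" by blast
  have "(h has_vector_derivative (c * a) * exp (a * complex_of_real x)) (at x)" for x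
    unfolding h mult.assoc
    by (intro has_vector_derivative_mult_right has_vector_derivative_exp_mult)
  then show "\<exists>h'. (\<exists>c. h' = (\<lambda>x. c * exp (a * complex_of_real x))) \<and>
      (\<forall>x. (h has_vector_derivative h' x) (at x))"
    by blast
qed blast

lemma smooth_fun_affine:
  assumes "smooth_fun g"
  shows "smooth_fun (\<lambda>x. g (a * x + b))"
proof -
  \<comment> \<open>Each derivative brings out a factor \<open>a\<close>, so the closed class has to
    contain scalar multiples; the claim is the case \<open>c = 1\<close>.\<close>
  have "smooth_fun (\<lambda>x. of_real c * g (a * x + b))" for c
  proof (rule smooth_fun_coinduct[of
        "\<lambda>k. \<exists>c h. smooth_fun h \<and> k = (\<lambda>x. of_real c * h (a * x + b))"])
    fix k assume "\<exists>c h. smooth_fun h \<and> k = (\<lambda>x. of_real c * h (a * x + b))"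
    then obtain c h where k: "smooth_fun h" "k = (\<lambda>x. of_real c * h (a * x + b))" by blast
    then obtain h' where h': "smooth_fun h'" "\<And>x. (h has_vector_derivative h' x) (at x)"
      by (meson smooth_fun_derivE)
    have "((\<lambda>x. h (a * x + b)) has_vector_derivative a *\<^sub>R h' (a * x + b)) (at x)" for x
    proof -
      have "((\<lambda>x. a * x + b) has_vector_derivative a) (at x)"
        unfolding has_real_derivative_iff_has_vector_derivative[symmetric]
        by (auto intro!: derivative_eq_intros)
      from vector_diff_chain_at[OF this h'(2)] show ?thesis by (simp add: o_def)
    qed
    then have "(k has_vector_derivative of_real (c * a) * h' (a * x + b)) (at x)" for x
      unfolding k using has_vector_derivative_mult_right[of "\<lambda>x. h (a * x + b)" "a *\<^sub>R h' (a * x + b)" "at x" "of_real c"]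
      by (simp add: scaleR_conv_of_real mult.assoc)
    then show "\<exists>k'. (\<exists>c h. smooth_fun h \<and> k' = (\<lambda>x. of_real c * h (a * x + b))) \<and>
        (\<forall>x. (k has_vector_derivative k' x) (at x))"
      using h'(1) by blast
  qed (use assms in blast)
  from this[of 1] show ?thesis by simp
qed

section \<open>Functions flat at 0 and the bumps built from them\<close>

text \<open>For \<open>p = 1\<close> this is the classical exp(-1/x). The polynomial in 1/x makes
  the family closed under differentiation.\<close>

definition flat_fun :: "real poly \<Rightarrow> real \<Rightarrow> real" where
  "flat_fun p x = (if x > 0 then poly p (1 / x) * exp (- 1 / x) else 0)"

lemma tendsto_poly_exp_minus: "((\<lambda>x. poly p x * exp (- x)) \<longlongrightarrow> 0) at_top" for p :: "real poly"
proof -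
  have "((\<lambda>x. \<Sum>i\<le>degree p. coeff p i * (x ^ i / exp x)) \<longlongrightarrow> (\<Sum>i\<le>degree p. coeff p i * 0)) at_top"
    by (intro tendsto_sum tendsto_mult tendsto_const tendsto_power_div_exp_0)
  then show ?thesis
    by (simp add: poly_altdef sum_distrib_right sum_divide_distrib exp_minus field_simps)
qed

text \<open>With u = 1/x one has d/dx = -u^2 d/du, and the u-derivative of p(u) exp(-u) is (p' -
  p)(u) exp(-u); this explains the polynomial u^2 (p - p'). At 0 the exponential beats every power
  of u.\<close>

lemma flat_fun_deriv:
  "(flat_fun p has_real_derivative flat_fun ([:0, 0, 1:] * (p - pderiv p)) x) (at x)"
proof -
  consider "x > 0" | "x < 0" | "x = 0" by linarith
  then show ?thesis
  proof cases
    case 1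
    have "((\<lambda>x. poly p (1 / x) * exp (- 1 / x)) has_real_derivative
        flat_fun ([:0, 0, 1:] * (p - pderiv p)) x) (at x)"
      using 1 by (auto intro!: derivative_eq_intros poly_DERIV[THEN DERIV_chain2]
          simp: flat_fun_def power2_eq_square field_simps)
    moreover have "\<forall>\<^sub>F y in nhds x. poly p (1 / y) * exp (- 1 / y) = flat_fun p y"
      using eventually_nhds_in_open[of "{0<..}" x] 1
      by (auto elim!: eventually_mono simp: flat_fun_def)
    ultimately show ?thesis
      by (rule DERIV_cong_ev[OF refl _ refl, THEN iffD1, rotated])
  next
    case 2
    have "\<forall>\<^sub>F y in nhds x. 0 = flat_fun p y"
      using eventually_nhds_in_open[of "{..<0}" x] 2
      by (auto elim!: eventually_mono simp: flat_fun_def)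
    moreover have "((\<lambda>x. 0) has_real_derivative flat_fun ([:0, 0, 1:] * (p - pderiv p)) x) (at x)"
      using 2 by (simp add: flat_fun_def)
    ultimately show ?thesis
      by (rule DERIV_cong_ev[OF refl _ refl, THEN iffD1])
  next
    case 3
    have "((\<lambda>y. flat_fun p y / y) \<longlongrightarrow> 0) (at 0)"
    proof (rule filterlim_split_at)
      \<comment> \<open>The difference quotient at 0 divides by y, that is, multiplies by u = 1/y,
        whence the extra factor \<open>[:0, 1:]\<close>.\<close>
      have "((\<lambda>y. poly ([:0, 1:] * p) (inverse y) * exp (- inverse y)) \<longlongrightarrow> 0) (at_right 0)"
        using tendsto_poly_exp_minus filterlim_inverse_at_top_right by (rule filterlim_compose)
      moreover have "\<forall>\<^sub>F y in at_right 0. poly ([:0, 1:] * p) (inverse y) * exp (- inverse y) = flat_fun p y / y"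
        by (auto simp: eventually_at_right_less flat_fun_def field_simps eventually_at_filter)
      ultimately show "((\<lambda>y. flat_fun p y / y) \<longlongrightarrow> 0) (at_right 0)"
        by (rule Lim_transform_eventually)
      have "\<forall>\<^sub>F y in at_left 0. 0 = flat_fun p y / y"
        by (auto simp: flat_fun_def eventually_at_filter)
      then show "((\<lambda>y. flat_fun p y / y) \<longlongrightarrow> 0) (at_left 0)"
        by (rule Lim_transform_eventually[OF tendsto_const])
    qed
    then show ?thesis
      using 3 by (simp add: has_field_derivative_iff flat_fun_def)
  qed
qed

lemma smooth_fun_flat_fun: "smooth_fun (\<lambda>x. complex_of_real (flat_fun p x))"
proof (rule smooth_fun_coinduct[of "\<lambda>g. \<exists>p. g = (\<lambda>x. complex_of_real (flat_fun p x))"])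
  fix h assume "\<exists>p. h = (\<lambda>x. complex_of_real (flat_fun p x))"
  then obtain p where h: "h = (\<lambda>x. complex_of_real (flat_fun p x))" by blast
  show "\<exists>h'. (\<exists>p. h' = (\<lambda>x. complex_of_real (flat_fun p x))) \<and>
      (\<forall>x. (h has_vector_derivative h' x) (at x))"
    unfolding h using has_vector_derivative_of_real[OF flat_fun_deriv] by blast
qed blast

text \<open>One flat factor cuts off at each end of (-r, r). The symmetric form makes the bump even,
  so that its transform is real on the real axis.\<close>

definition bump :: "real \<Rightarrow> real \<Rightarrow> real" where
  "bump r x = flat_fun 1 (r + x) * flat_fun 1 (r - x)"

lemma bump_nonneg: "bump r x \<ge> 0"
  by (simp add: bump_def flat_fun_def)

lemma bump_eq_0: "\<bar>x\<bar> \<ge> r \<Longrightarrow> bump r x = 0"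
  by (auto simp: bump_def flat_fun_def)

lemma bump_minus [simp]: "bump r (- x) = bump r x"
  by (simp add: bump_def)

section \<open>Closure properties of test functions\<close>

lemma test_funI:
  assumes "smooth_fun g" and "\<And>x. \<bar>x\<bar> > R \<Longrightarrow> g x = 0"
  shows "test_fun g"
proof -
  have "{t. g t \<noteq> 0} \<subseteq> {-R..R}"
    using assms(2) by force
  then show ?thesis
    unfolding test_fun_iff using assms(1) bounded_subset[OF bounded_closed_interval] compact_closure by blast
qed

lemma test_fun_bump: "test_fun (\<lambda>x. complex_of_real (bump r x))"
proof -
  have "smooth_fun (\<lambda>x. complex_of_real (flat_fun 1 (1 * x + r)) * complex_of_real (flat_fun 1 (- 1 * x + r)))"
    by (intro smooth_fun_mult smooth_fun_affine[of "\<lambda>x. complex_of_real (flat_fun 1 x)"] smooth_fun_flat_fun)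
  then show ?thesis
    by (intro test_funI[of _ r]) (simp_all add: bump_eq_0, simp add: bump_def add.commute)
qed

lemma test_fun_suppE:
  assumes "test_fun g"
  obtains R where "R > 0" "\<And>x. \<bar>x\<bar> \<ge> R \<Longrightarrow> g x = 0"
proof -
  have "bounded {t. g t \<noteq> 0}"
    using assms unfolding test_fun_iff using compact_imp_bounded bounded_subset closure_subset by metis
  then obtain B where B: "\<forall>x\<in>{t. g t \<noteq> 0}. norm x \<le> B" "B > 0"
    unfolding bounded_pos by blast
  show thesis
    by (rule that[of "B + 1"]) (use B in force)+
qed

lemma test_fun_continuous: "test_fun g \<Longrightarrow> continuous_on A g"
  by (simp add: test_fun_iff smooth_fun_continuous)

lemma test_fun_smooth_mult:
  assumes "test_fun g" "smooth_fun h"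
  shows "test_fun (\<lambda>x. g x * h x)"
proof -
  obtain R where "R > 0" "\<And>x. \<bar>x\<bar> \<ge> R \<Longrightarrow> g x = 0"
    using assms by (meson test_fun_suppE)
  then show ?thesis
    using assms by (intro test_funI[of _ R] smooth_fun_mult) (auto simp: test_fun_iff)
qed

lemma test_fun_affine:
  assumes "test_fun g" "a \<noteq> 0"
  shows "test_fun (\<lambda>x. g (a * x + b))"
proof -
  obtain R where R: "R > 0" "\<And>x. \<bar>x\<bar> \<ge> R \<Longrightarrow> g x = 0"
    using assms by (meson test_fun_suppE)
  have "g (a * x + b) = 0" if "\<bar>x\<bar> > (R + \<bar>b\<bar>) / \<bar>a\<bar>" for x
  proof (rule R(2))
    have "\<bar>a * x\<bar> > R + \<bar>b\<bar>"
      using that assms(2) by (simp add: abs_mult field_simps)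
    then show "\<bar>a * x + b\<bar> \<ge> R" by linarith
  qed
  then show ?thesis
    using assms by (intro test_funI smooth_fun_affine) (auto simp: test_fun_iff)
qed

lemma test_fun_derivE:
  assumes "test_fun g"
  obtains g' where "test_fun g'" "\<And>x. (g has_vector_derivative g' x) (at x)"
proof -
  obtain g' where g': "smooth_fun g'" "\<And>x. (g has_vector_derivative g' x) (at x)"
    using assms by (meson test_fun_iff smooth_fun_derivE)
  obtain R where R: "R > 0" "\<And>x. \<bar>x\<bar> \<ge> R \<Longrightarrow> g x = 0"
    using assms by (meson test_fun_suppE)
  have "g' x = 0" if "\<bar>x\<bar> > R" for x
  proof -
    have "((\<lambda>_. 0) has_vector_derivative 0) (at x)" by simp
    moreover have "open (- {-R..R})" "x \<in> - {-R..R}"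
      using that by (auto simp: open_Compl)
    ultimately have "(g has_vector_derivative 0) (at x)"
      by (rule has_vector_derivative_transform_within_open) (use R(2) in force)
    then show ?thesis
      using g'(2) vector_derivative_unique_at by blast
  qed
  then have "test_fun g'"
    using g' by (intro test_funI)
  then show thesis using g'(2) that by blast
qed

section \<open>The c-Fourier transform of test functions\<close>

text \<open>Stated for all Euclidean spaces since Fubini in \<open>cfourier_convolution\<close>
  needs it on the plane.\<close>

lemma integrable_continuous_compact_support:
  fixes g :: "'a::euclidean_space \<Rightarrow> complex"
  assumes "continuous_on UNIV g" "compact S" "\<And>x. x \<notin> S \<Longrightarrow> g x = 0"
  shows "integrable lborel g"
proof -
  have "(\<lambda>x. indicator S x *\<^sub>R g x) = g"
    using assms(3) by (auto simp: indicator_def)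
  then show ?thesis
    using borel_integrable_compact[of S g] assms continuous_on_subset[of UNIV g S] by auto
qed

lemma integrable_test_fun_mult:
  assumes "test_fun g" "continuous_on UNIV h"
  shows "integrable lborel (\<lambda>t. g t * h t)"
proof -
  obtain R where R: "R > 0" "\<And>x. \<bar>x\<bar> \<ge> R \<Longrightarrow> g x = 0"
    using assms by (meson test_fun_suppE)
  show ?thesis
  proof (rule integrable_continuous_compact_support[of _ "{-R..R}"])
    show "continuous_on UNIV (\<lambda>t. g t * h t)"
      by (intro continuous_intros test_fun_continuous assms)
    show "g x * h x = 0" if "x \<notin> {-R..R}" for x
      using R(2)[of x] that by auto
  qed auto
qed

lemma borel_measurable_test_fun: "test_fun g \<Longrightarrow> g \<in> borel_measurable borel"
  by (simp add: borel_measurable_continuous_onI test_fun_continuous)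

lemma borel_measurable_cfourier:
  assumes "test_fun g"
  shows "cfourier g \<in> borel_measurable borel"
  unfolding cfourier_def[abs_def] using borel_measurable_test_fun[OF assms]
  by measurable

lemma norm_fourier_kernel:
  "norm (exp (- (2 * pi * \<i>) * z * complex_of_real t)) = exp (2 * pi * Im z * t)"
  by simp

text \<open>The kernel has modulus exp(2 pi t Im z), at most exp(2 pi H R) on a support inside
  [-R, R].\<close>

lemma cfourier_bounded:
  assumes "test_fun g"
  shows "\<exists>C\<ge>0. \<forall>z. \<bar>Im z\<bar> \<le> H \<longrightarrow> norm (cfourier g z) \<le> C"
proof -
  obtain R where R: "R > 0" "\<And>x. \<bar>x\<bar> \<ge> R \<Longrightarrow> g x = 0"
    using assms by (meson test_fun_suppE)
  let ?C = "\<integral>t. norm (g t) * exp (2 * pi * H * R) \<partial>lborel"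
  have int: "integrable lborel (\<lambda>t. norm (g t) * exp (2 * pi * H * R))"
    using integrable_test_fun_mult[OF assms, of "\<lambda>_. 1"] by auto
  have "norm (cfourier g z) \<le> ?C" if "\<bar>Im z\<bar> \<le> H" for z
  proof -
    have "norm (g t * exp (- (2 * pi * \<i>) * z * complex_of_real t)) \<le> norm (g t) * exp (2 * pi * H * R)" for t
    proof (cases "\<bar>t\<bar> \<ge> R")
      case False
      have "Im z * t \<le> \<bar>Im z\<bar> * \<bar>t\<bar>"
        by (metis abs_ge_self abs_mult)
      also have "\<dots> \<le> H * R"
        using that False by (intro mult_mono) auto
      finally show ?thesis
        unfolding norm_mult norm_fourier_kernel by (intro mult_left_mono) (auto simp: mult.assoc)
    qed (use R in auto)
    then show ?thesis
      unfolding cfourier_def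
      by (intro Bochner_Integration.integral_norm_bound_integral[OF _ int] integrable_test_fun_mult assms) (auto intro!: continuous_intros)
  qed
  moreover have "?C \<ge> 0" by simp
  ultimately show ?thesis by blast
qed

lemma cfourier_deriv:
  assumes "test_fun g" "test_fun g'" and deriv: "\<And>x. (g has_vector_derivative g' x) (at x)"
  shows "cfourier g' z = 2 * pi * \<i> * z * cfourier g z"
proof -
  obtain R where R: "R > 0" "\<And>x. \<bar>x\<bar> \<ge> R \<Longrightarrow> g x = 0"
    using test_fun_suppE[OF assms(1)] by blast
  obtain R' where R': "R' > 0" "\<And>x. \<bar>x\<bar> \<ge> R' \<Longrightarrow> g' x = 0"
    using test_fun_suppE[OF assms(2)] by blast
  \<comment> \<open>A common radius for both supports: restricting to [-Q, Q] loses nothing, and the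
    boundary terms of the integration by parts vanish.\<close>
  define Q where "Q = max R R'"
  have Q: "Q > 0" "Q \<ge> R" "Q \<ge> R'" using R(1) by (auto simp: Q_def)
  define e where "e t = exp (- (2 * pi * \<i>) * z * complex_of_real t)" for t
  have e': "(e has_vector_derivative (- (2 * pi * \<i>) * z * e t)) (at t)" for t
    unfolding e_def by (rule has_vector_derivative_exp_mult)
  have ce: "continuous_on A e" for A
    unfolding e_def by (intro continuous_intros)
  let ?F = "\<lambda>t. g t * (- (2 * pi * \<i>) * z * e t) + g' t * e t"
  have "(\<integral>t. indicator {-Q..Q} t *\<^sub>R ?F t \<partial>lborel) = g Q * e Q - g (-Q) * e (-Q)"
  proof (rule integral_FTC_Icc)
    show "((\<lambda>t. g t * e t) has_vector_derivative ?F x) (at x within {-Q..Q})" for x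
      by (rule has_vector_derivative_at_within[OF has_vector_derivative_mult[OF deriv e']])
    show "continuous_on {-Q..Q} ?F"
      by (intro continuous_intros ce test_fun_continuous assms)
  qed (use Q in linarith)
  also have "\<dots> = 0"
    using Q by (simp add: R(2))
  also have "(\<lambda>t. indicator {-Q..Q} t *\<^sub>R ?F t) = ?F"
  proof
    fix t show "indicator {-Q..Q} t *\<^sub>R ?F t = ?F t"
    proof (cases "t \<in> {-Q..Q}")
      case False
      then have "g t = 0" "g' t = 0" using R(2)[of t] R'(2)[of t] Q by auto
      then show ?thesis by simp
    qed simp
  qed
  finally have "(\<integral>t. ?F t \<partial>lborel) = 0" .
  also have "?F = (\<lambda>t. (- (2 * pi * \<i>) * z) * (g t * e t) + g' t * e t)"
    by (simp only: mult_ac)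
  also have "(\<integral>t. (- (2 * pi * \<i>) * z) * (g t * e t) + g' t * e t \<partial>lborel) =
      (- (2 * pi * \<i>) * z) * (\<integral>t. g t * e t \<partial>lborel) + (\<integral>t. g' t * e t \<partial>lborel)"
    using integrable_test_fun_mult[OF assms(1) ce] integrable_test_fun_mult[OF assms(2) ce]
    by (simp only: Bochner_Integration.integral_add integrable_mult_right integral_mult_right_zero)
  finally show ?thesis
    by (simp add: cfourier_def e_def add_eq_0_iff)
qed

text \<open>Each differentiation multiplies the transform by 2 pi i z, whose modulus is at least |Re
  z|; so n powers of |Re z| are absorbed by the n-th derivative, whose transform is bounded on the
  strip.\<close>

lemma cfourier_power_bound:
  assumes "test_fun g"
  shows "\<exists>C\<ge>0. \<forall>z. \<bar>Im z\<bar> \<le> H \<longrightarrow> \<bar>Re z\<bar> ^ n * norm (cfourier g z) \<le> C"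
  using assms
proof (induction n arbitrary: g)
  case 0
  then show ?case using cfourier_bounded[of g H] by simp
next
  case (Suc n)
  obtain g' where g': "test_fun g'" "\<And>x. (g has_vector_derivative g' x) (at x)"
    using Suc.prems test_fun_derivE by blast
  obtain C where C: "C \<ge> 0" "\<And>z. \<bar>Im z\<bar> \<le> H \<Longrightarrow> \<bar>Re z\<bar> ^ n * norm (cfourier g' z) \<le> C"
    using Suc.IH[OF g'(1)] by blast
  have "\<bar>Re z\<bar> ^ Suc n * norm (cfourier g z) \<le> C" if "\<bar>Im z\<bar> \<le> H" for z
  proof -
    have "1 * \<bar>Re z\<bar> \<le> (2 * pi) * norm z"
      using pi_gt3 by (intro mult_mono abs_Re_le_cmod) auto
    then have "\<bar>Re z\<bar> * norm (cfourier g z) \<le> norm (cfourier g' z)"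
      unfolding cfourier_deriv[OF Suc.prems g'] norm_mult by (intro mult_right_mono) auto
    then have "\<bar>Re z\<bar> ^ n * (\<bar>Re z\<bar> * norm (cfourier g z)) \<le> \<bar>Re z\<bar> ^ n * norm (cfourier g' z)"
      by (intro mult_left_mono) auto
    also have "\<dots> \<le> C" using C that by blast
    finally show ?thesis by (simp add: mult_ac)
  qed
  then show ?case using C by blast
qed

lemma cfourier_decay:
  assumes "test_fun g"
  shows "\<exists>C\<ge>0. \<forall>z. \<bar>Im z\<bar> \<le> H \<longrightarrow> norm (cfourier g z) \<le> C / (1 + \<bar>Re z\<bar>) ^ n"
proof -
  obtain C0 where C0: "C0 \<ge> 0" "\<And>z. \<bar>Im z\<bar> \<le> H \<Longrightarrow> norm (cfourier g z) \<le> C0"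
    using cfourier_bounded[OF assms] by blast
  obtain C1 where C1: "C1 \<ge> 0" "\<And>z. \<bar>Im z\<bar> \<le> H \<Longrightarrow> \<bar>Re z\<bar> ^ n * norm (cfourier g z) \<le> C1"
    using cfourier_power_bound[OF assms] by blast
  have "norm (cfourier g z) \<le> 2 ^ n * (C0 + C1) / (1 + \<bar>Re z\<bar>) ^ n" if z: "\<bar>Im z\<bar> \<le> H" for z
  proof -
    have "(1 + \<bar>Re z\<bar>) ^ n \<le> 2 ^ n * (1 + \<bar>Re z\<bar> ^ n)"
    proof (cases "\<bar>Re z\<bar> \<le> 1")
      case True
      have "(1 + \<bar>Re z\<bar>) ^ n \<le> 2 ^ n" using True by (intro power_mono) auto
      also have "\<dots> * 1 \<le> 2 ^ n * (1 + \<bar>Re z\<bar> ^ n)" by (intro mult_left_mono) auto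
      finally show ?thesis by simp
    next
      case False
      have "(1 + \<bar>Re z\<bar>) ^ n \<le> (2 * \<bar>Re z\<bar>) ^ n" using False by (intro power_mono) auto
      then show ?thesis by (simp add: power_mult_distrib distrib_left add_increasing)
    qed
    then have "(1 + \<bar>Re z\<bar>) ^ n * norm (cfourier g z) \<le> 2 ^ n * (1 + \<bar>Re z\<bar> ^ n) * norm (cfourier g z)"
      by (intro mult_right_mono) auto
    also have "\<dots> = 2 ^ n * (norm (cfourier g z) + \<bar>Re z\<bar> ^ n * norm (cfourier g z))"
      by (simp add: algebra_simps)
    also have "\<dots> \<le> 2 ^ n * (C0 + C1)"
      using C0(2)[OF z] C1(2)[OF z] by (intro mult_left_mono add_mono) auto
    finally show ?thesis
      by (subst pos_le_divide_eq) (auto simp: mult.commute add_pos_nonneg)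
  qed
  moreover have "2 ^ n * (C0 + C1) \<ge> 0" using C0 C1 by simp
  ultimately show ?thesis by blast
qed

text \<open>Used with real \<open>s\<close> to centre a kernel at any point of the strip's
  axis.\<close>

lemma cfourier_modulate:
  "cfourier (\<lambda>t. g t * exp (2 * pi * \<i> * s * complex_of_real t)) z = cfourier g (z - s)"
proof -
  have "exp (2 * pi * \<i> * s * complex_of_real t) * exp (- (2 * pi * \<i>) * z * complex_of_real t) =
      exp (- (2 * pi * \<i>) * (z - s) * complex_of_real t)" for t
    unfolding exp_add[symmetric] by (simp add: algebra_simps)
  then show ?thesis
    unfolding cfourier_def by (simp only: mult.assoc)
qed

lemma cfourier_translate:
  "cfourier (\<lambda>t. g (t - \<tau>)) z = exp (- (2 * pi * \<i>) * z * complex_of_real \<tau>) * cfourier g z"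
proof -
  have "cfourier (\<lambda>t. g (t - \<tau>)) z =
      (LINT t|lborel. g t * exp (- (2 * pi * \<i>) * z * complex_of_real (\<tau> + t)))"
    unfolding cfourier_def
    by (subst lborel_integral_real_affine[of 1 _ \<tau>]) auto
  also have "(\<lambda>t. g t * exp (- (2 * pi * \<i>) * z * complex_of_real (\<tau> + t))) =
     (\<lambda>t. exp (- (2 * pi * \<i>) * z * complex_of_real \<tau>) * (g t * exp (- (2 * pi * \<i>) * z * complex_of_real t)))"
    by (intro ext) (simp add: ring_distribs exp_add exp_diff exp_minus divide_inverse)
  finally show ?thesis
    unfolding cfourier_def by simp
qed

text \<open>The prefactor \<open>L\<close> keeps the height of the transform fixed while widening it
  by the factor \<open>L\<close>; imaginary parts shrink by the same factor.\<close>

lemma cfourier_scale: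
  assumes "L > 0"
  shows "cfourier (\<lambda>t. of_real L * g (L * t)) z = cfourier g (z / of_real L)"
proof -
  have "cfourier g (z / of_real L) =
     L *\<^sub>R (LINT t|lborel. g (L * t) * exp (- (2 * pi * \<i>) * (z / of_real L) * complex_of_real (L * t)))"
    unfolding cfourier_def using assms
    by (subst lborel_integral_real_affine[of L _ 0]) auto
  also have "\<dots> = cfourier (\<lambda>t. of_real L * g (L * t)) z"
    unfolding cfourier_def using assms
    by (simp add: scaleR_conv_of_real mult.assoc)
  finally show ?thesis by simp
qed

section \<open>Convolution of test functions\<close>

definition convolution :: "(real \<Rightarrow> complex) \<Rightarrow> (real \<Rightarrow> complex) \<Rightarrow> real \<Rightarrow> complex" where
  "convolution g h t = (LINT u|lborel. g u * h (t - u))"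

text \<open>Derivatives fall on the second factor only, so the convolutions of \<open>g\<close> with
  arbitrary test functions form a class closed under differentiation.\<close>

lemma test_fun_convolution:
  assumes "test_fun g" "test_fun h"
  shows "test_fun (convolution g h)"
proof -
  obtain R where R: "R > 0" "\<And>x. \<bar>x\<bar> \<ge> R \<Longrightarrow> g x = 0"
    using assms by (meson test_fun_suppE)
  obtain R' where R': "R' > 0" "\<And>x. \<bar>x\<bar> \<ge> R' \<Longrightarrow> h x = 0"
    using assms by (meson test_fun_suppE)
  have cont: "continuous_on A (\<lambda>u. k (t - u))" if "test_fun k" for A t and k :: "real \<Rightarrow> complex"
    by (rule continuous_on_compose2[OF test_fun_continuous[OF that, of UNIV]])
      (auto intro!: continuous_intros)
  \<comment> \<open>Cutting the integral down to the support of \<open>g\<close> makes the Leibniz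
    rule on a compact interval applicable, with the same interval for every
    \<open>t\<close>.\<close>
  have conv: "convolution g k = (\<lambda>t. integral (cbox (-R) R) (\<lambda>u. g u * k (t - u)))" if k: "test_fun k" for k
  proof
    fix t
    have "integrable lborel (\<lambda>u. g u * k (t - u))"
      by (rule integrable_test_fun_mult[OF assms(1) cont[OF k]])
    then have "convolution g k t = integral UNIV (\<lambda>u. g u * k (t - u))"
      unfolding convolution_def by (rule integral_lborel[symmetric])
    also have "\<dots> = integral (cbox (-R) R) (\<lambda>u. g u * k (t - u))"
    proof -
      have "(\<lambda>u. g u * k (t - u)) = (\<lambda>u. if u \<in> cbox (-R) R then g u * k (t - u) else 0)"
      proof
        fix u show "g u * k (t - u) = (if u \<in> cbox (-R) R then g u * k (t - u) else 0)"
          using R(2)[of u] by auto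
      qed
      then show ?thesis
        using integral_restrict_UNIV[of "cbox (-R) R" "\<lambda>u. g u * k (t - u)"] by simp
    qed
    finally show "convolution g k t = \<dots>" .
  qed
  show ?thesis
  proof (rule test_funI[of _ "R + R'"])
    show "smooth_fun (convolution g h)"
    proof (rule smooth_fun_coinduct[of "\<lambda>f. \<exists>k. test_fun k \<and> f = convolution g k"])
      fix f assume "\<exists>k. test_fun k \<and> f = convolution g k"
      then obtain k where k: "test_fun k" "f = convolution g k" by blast
      obtain k' where k': "test_fun k'" "\<And>x. (k has_vector_derivative k' x) (at x)"
        using k(1) test_fun_derivE by blast
      have "(f has_vector_derivative convolution g k' x) (at x)" for x
        unfolding k conv[OF k(1)] conv[OF k'(1)]
      proof (rule leibniz_rule_vector_derivative[where U=UNIV])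
        fix x t
        have "((\<lambda>x. x - t) has_vector_derivative 1) (at x)"
          by (auto intro!: derivative_eq_intros)
        from vector_diff_chain_at[OF this k'(2)]
        have "((\<lambda>x. k (x - t)) has_vector_derivative k' (x - t)) (at x)"
          by (simp add: o_def)
        then show "((\<lambda>x. g t * k (x - t)) has_vector_derivative g t * k' (x - t)) (at x)"
          by (rule has_vector_derivative_mult_right)
        show "(\<lambda>u. g u * k (x - u)) integrable_on cbox (- R) R"
          by (intro integrable_continuous continuous_intros cont k test_fun_continuous assms)
        have "continuous_on (UNIV \<times> cbox (-R) R) (\<lambda>p::real\<times>real. g (snd p))"
          by (rule continuous_on_compose2[OF test_fun_continuous[OF assms(1), of UNIV]])
            (auto intro!: continuous_intros)
        moreover have "continuous_on (UNIV \<times> cbox (-R) R) (\<lambda>p::real\<times>real. k' (fst p - snd p))"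
          by (rule continuous_on_compose2[OF test_fun_continuous[OF k'(1), of UNIV]])
            (auto intro!: continuous_intros)
        ultimately show "continuous_on (UNIV \<times> cbox (-R) R) (\<lambda>(x, t). g t * k' (x - t))"
          by (simp add: case_prod_unfold continuous_on_mult)
      qed auto
      then show "\<exists>f'. (\<exists>k. test_fun k \<and> f' = convolution g k) \<and> (\<forall>x. (f has_vector_derivative f' x) (at x))"
        using k'(1) by blast
    qed (use assms in blast)
    fix x assume x: "\<bar>x\<bar> > R + R'"
    have "(\<lambda>u. g u * h (x - u)) = (\<lambda>_. 0)"
    proof
      fix u
      have "\<bar>u\<bar> \<ge> R \<or> \<bar>x - u\<bar> \<ge> R'" using x by linarith
      then show "g u * h (x - u) = 0" using R R' by auto
    qed
    then show "convolution g h x = 0"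
      unfolding convolution_def by simp
  qed
qed

text \<open>The joint integrand is continuous with compact support, so Fubini applies at every
  complex \<open>z\<close>; the inner integral is the transform of a translate of
  \<open>h\<close>.\<close>

lemma cfourier_convolution:
  assumes "test_fun g" "test_fun h"
  shows "cfourier (convolution g h) z = cfourier g z * cfourier h z"
proof -
  obtain R where R: "R > 0" "\<And>x. \<bar>x\<bar> \<ge> R \<Longrightarrow> g x = 0"
    using assms by (meson test_fun_suppE)
  obtain R' where R': "R' > 0" "\<And>x. \<bar>x\<bar> \<ge> R' \<Longrightarrow> h x = 0"
    using assms by (meson test_fun_suppE)
  define e where "e t = exp (- (2 * pi * \<i>) * z * complex_of_real t)" for t
  have e_add: "e t = e u * e (t - u)" for t u
    unfolding e_def by (simp flip: exp_add add: algebra_simps)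
  let ?k = "\<lambda>(t, u). g u * h (t - u) * e t"
  have "integrable lborel ?k"
  proof (rule integrable_continuous_compact_support[of _ "cbox (-(R + R')) (R + R') \<times> cbox (-R) R"])
    have "continuous_on UNIV (\<lambda>p::real\<times>real. g (snd p))"
      by (rule continuous_on_compose2[OF test_fun_continuous[OF assms(1), of UNIV]])
        (auto intro!: continuous_intros)
    moreover have "continuous_on UNIV (\<lambda>p::real\<times>real. h (fst p - snd p))"
      by (rule continuous_on_compose2[OF test_fun_continuous[OF assms(2), of UNIV]])
        (auto intro!: continuous_intros)
    ultimately show "continuous_on UNIV ?k"
      unfolding case_prod_unfold e_def by (intro continuous_intros)
    fix p :: "real \<times> real"
    assume p: "p \<notin> cbox (-(R + R')) (R + R') \<times> cbox (-R) R"
    then have "\<bar>snd p\<bar> \<ge> R \<or> \<bar>fst p - snd p\<bar> \<ge> R'"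
      by (cases p) auto
    then show "?k p = 0"
      using R R' by (auto simp: case_prod_unfold)
  qed (intro compact_Times compact_cbox)
  then have int: "integrable (lborel \<Otimes>\<^sub>M lborel) ?k"
    by (simp add: lborel_prod)
  have "cfourier (convolution g h) z = (LINT t|lborel. LINT u|lborel. g u * h (t - u) * e t)"
    unfolding cfourier_def convolution_def e_def by simp
  also have "\<dots> = (LINT u|lborel. LINT t|lborel. g u * h (t - u) * e t)"
    using lborel_pair.Fubini_integral[OF int] by simp
  also have "\<dots> = (LINT u|lborel. g u * e u * cfourier h z)"
  proof (rule Bochner_Integration.integral_cong)
    fix u
    have "(LINT t|lborel. g u * h (t - u) * e t) = g u * cfourier (\<lambda>t. h (t - u)) z"
      unfolding cfourier_def e_def mult.assoc[of "g u"] by simp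
    then show "(LINT t|lborel. g u * h (t - u) * e t) = g u * e u * cfourier h z"
      by (simp add: cfourier_translate e_def)
  qed simp
  also have "\<dots> = cfourier g z * cfourier h z"
    unfolding cfourier_def e_def by simp
  finally show ?thesis .
qed

section \<open>Masses of vertical windows and an almost positive kernel\<close>

lemma inverse_squares_summable: "summable (\<lambda>n. 1 / (1 + real n) ^ 2)"
  using inverse_power_summable[of 2, where 'a=real] summable_Suc_iff[of "\<lambda>n. inverse (real n ^ 2)"]
  by (simp add: inverse_eq_divide add.commute)

text \<open>The \<open>n + 1\<close> centres are 2L apart and symmetric about \<open>s\<close>, so
  that for positive \<open>L\<close> their windows tile the large one.\<close>

lemma emeasure_window_le:
  fixes \<nu> :: "complex measure"
  assumes sets: "sets \<nu> = sets borel"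
  shows "emeasure \<nu> {z. \<bar>Re z - s\<bar> \<le> L * (1 + real n)} \<le>
    (\<Sum>i\<le>n. emeasure \<nu> {z. \<bar>Re z - (s + (2 * real i - real n) * L)\<bar> \<le> L})"
proof (cases "L \<ge> 0")
  case True
  let ?A = "\<lambda>i. {z. \<bar>Re z - (s + (2 * real i - real n) * L)\<bar> \<le> L}"
  have meas: "?A i \<in> sets \<nu>" for i unfolding sets by measurable
  have "\<exists>i\<le>n. \<bar>x - (s + (2 * real i - real n) * L)\<bar> \<le> L" if "\<bar>x - s\<bar> \<le> L * (1 + real n)" for x
    using that
  proof (induction n arbitrary: s)
    case (Suc n)
    show ?case
    \<comment> \<open>The leftmost window is split off; what remains is a smaller large window
      recentred at \<open>s + L\<close>.\<close>
    proof (cases "x \<le> s - L * real n")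
      case True
      then show ?thesis using Suc.prems by (intro exI[of _ 0]) (auto simp: algebra_simps)
    next
      case False
      then have "\<bar>x - (s + L)\<bar> \<le> L * (1 + real n)"
        using Suc.prems by (auto simp: algebra_simps)
      from Suc.IH[OF this] obtain i where i: "i \<le> n" "\<bar>x - (s + L + (2 * real i - real n) * L)\<bar> \<le> L"
        by blast
      then show ?thesis by (intro exI[of _ "Suc i"]) (auto simp: algebra_simps)
    qed
  qed auto
  then have "{z. \<bar>Re z - s\<bar> \<le> L * (1 + real n)} \<subseteq> (\<Union>i\<in>{..n}. ?A i)" by auto
  then have "emeasure \<nu> {z. \<bar>Re z - s\<bar> \<le> L * (1 + real n)} \<le> emeasure \<nu> (\<Union>i\<in>{..n}. ?A i)"
    using meas by (intro emeasure_mono) auto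
  also have "\<dots> \<le> (\<Sum>i\<le>n. emeasure \<nu> (?A i))"
    using meas by (intro emeasure_subadditive_finite) auto
  finally show ?thesis .
next
  case False
  then have "L * (1 + real n) < 0" by (simp add: mult_neg_pos)
  then have "{z. \<bar>Re z - s\<bar> \<le> L * (1 + real n)} = {}" by auto
  then show ?thesis by simp
qed

text \<open>The exponent \<open>q + 3\<close> is spent as follows: q powers on the growth of the
  window bound away from \<open>s\<close>, one on the number of windows in a layer, and two on the
  convergence of the sum over layers. The two-term bound is the shape that the recursion preserves;
  with \<open>\<beta> = 0\<close> it covers translation bounded measures.\<close>

lemma window_bound_imp_weight_bound:
  fixes \<nu> :: "complex measure"
  assumes sets: "sets \<nu> = sets borel" and L: "L > 0" and ab: "\<alpha> \<ge> 0" "\<beta> \<ge> 0"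
    and h: "\<And>s. emeasure \<nu> {z. \<bar>Re z - s\<bar> \<le> L} \<le> ennreal (\<alpha> + \<beta> * (1 + \<bar>s\<bar> / L) ^ q)"
  shows "integrable \<nu> (\<lambda>z. 1 / (1 + \<bar>Re z - s\<bar> / L) ^ (q + 3))" (is ?int)
    and "(LINT z|\<nu>. 1 / (1 + \<bar>Re z - s\<bar> / L) ^ (q + 3)) \<le>
           (\<Sum>n. 1 / (1 + real n) ^ 2) * (\<alpha> + \<beta> * (1 + \<bar>s\<bar> / L) ^ q)" (is ?le)
proof -
  define V where "V = \<alpha> + \<beta> * (1 + \<bar>s\<bar> / L) ^ q"
  let ?w = "\<lambda>z. 1 / (1 + \<bar>Re z - s\<bar> / L) ^ (q + 3)"
  have V: "V \<ge> 0" using ab L by (simp add: V_def)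
  have wnn: "?w z \<ge> 0" for z using L by simp
  have meas: "?w \<in> borel_measurable \<nu>"
    unfolding measurable_cong_sets[OF sets refl] by measurable
  let ?S = "\<lambda>n. {z. \<bar>Re z - s\<bar> \<le> L * (1 + real n)}"
  have Smeas: "?S n \<in> sets \<nu>" for n unfolding sets by measurable
  \<comment> \<open>A point at distance between nL and (n + 1)L from the line Re z =
    \<open>s\<close> is charged to layer n, where the weight is at most (1 + n)^-(q+3).\<close>
  have pt: "ennreal (?w z) \<le> (\<Sum>n. ennreal (1 / (1 + real n) ^ (q + 3)) * indicator (?S n) z)" for z
  proof -
    define n where "n = nat \<lfloor>\<bar>Re z - s\<bar> / L\<rfloor>"
    have "\<bar>Re z - s\<bar> / L \<ge> 0" using L by simp
    then have n: "real n \<le> \<bar>Re z - s\<bar> / L" "\<bar>Re z - s\<bar> / L \<le> 1 + real n"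
      unfolding n_def by linarith+
    have "?w z \<le> 1 / (1 + real n) ^ (q + 3)"
      using n by (intro divide_left_mono power_mono mult_pos_pos zero_less_power) auto
    moreover have "z \<in> ?S n" using n L by (simp add: field_simps)
    ultimately have "ennreal (?w z) \<le> ennreal (1 / (1 + real n) ^ (q + 3)) * indicator (?S n) z"
      by (simp add: ennreal_leI)
    also have "\<dots> \<le> (\<Sum>n. ennreal (1 / (1 + real n) ^ (q + 3)) * indicator (?S n) z)"
    proof -
      have "f n \<le> suminf f" for f :: "nat \<Rightarrow> ennreal"
        using sum_le_suminf[OF summableI, of "{n}" f] by simp
      then show ?thesis .
    qed
    finally show ?thesis .
  qed
  have S: "emeasure \<nu> (?S n) \<le> ennreal ((1 + real n) ^ (q + 1) * V)" for n
  proof -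
    have "emeasure \<nu> (?S n) \<le> (\<Sum>i\<le>n. emeasure \<nu> {z. \<bar>Re z - (s + (2 * real i - real n) * L)\<bar> \<le> L})"
      by (rule emeasure_window_le[OF sets])
    also have "\<dots> \<le> (\<Sum>i\<le>n. ennreal ((1 + real n) ^ q * V))"
    proof (rule sum_mono)
      fix i assume i: "i \<in> {..n}"
      let ?s = "s + (2 * real i - real n) * L"
      have "\<bar>(2 * real i - real n) * L\<bar> = \<bar>2 * real i - real n\<bar> * L"
        using L by (simp add: abs_mult)
      also have "\<dots> \<le> real n * L"
        using i L by (intro mult_right_mono) auto
      finally have "\<bar>?s\<bar> \<le> \<bar>s\<bar> + real n * L" by linarith
      then have "\<bar>?s\<bar> / L \<le> \<bar>s\<bar> / L + real n" using L by (simp add: field_simps)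
      moreover have "(1 + real n) * (1 + \<bar>s\<bar> / L) = 1 + real n + \<bar>s\<bar> / L + real n * (\<bar>s\<bar> / L)"
        by (simp add: algebra_simps add_divide_distrib)
      moreover have "real n * (\<bar>s\<bar> / L) \<ge> 0" using L by simp
      \<comment> \<open>This product form separates the dependence on the layer from that on
        \<open>s\<close>, so that one \<open>V\<close> serves for all layers.\<close>
      ultimately have "1 + \<bar>?s\<bar> / L \<le> (1 + real n) * (1 + \<bar>s\<bar> / L)"
        by linarith
      then have "(1 + \<bar>?s\<bar> / L) ^ q \<le> ((1 + real n) * (1 + \<bar>s\<bar> / L)) ^ q"
        using L by (intro power_mono) auto
      then have "\<beta> * (1 + \<bar>?s\<bar> / L) ^ q \<le> \<beta> * ((1 + real n) ^ q * (1 + \<bar>s\<bar> / L) ^ q)"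
        using ab by (intro mult_left_mono) (auto simp: power_mult_distrib)
      moreover have "1 * \<alpha> \<le> (1 + real n) ^ q * \<alpha>"
        using ab by (intro mult_right_mono one_le_power) auto
      ultimately have "\<alpha> + \<beta> * (1 + \<bar>?s\<bar> / L) ^ q \<le> (1 + real n) ^ q * V"
        by (simp add: V_def algebra_simps)
      then show "emeasure \<nu> {z. \<bar>Re z - ?s\<bar> \<le> L} \<le> ennreal ((1 + real n) ^ q * V)"
        using h[of ?s] ennreal_leI order_trans by blast
    qed
    also have "\<dots> = ennreal ((1 + real n) ^ (q + 1) * V)"
    proof -
      have "(\<Sum>i\<le>n. ennreal ((1 + real n) ^ q * V)) = ennreal (real (Suc n)) * ennreal ((1 + real n) ^ q * V)"
        by (simp add: ennreal_of_nat_eq_real_of_nat del: of_nat_Suc)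
      also have "\<dots> = ennreal (real (Suc n) * ((1 + real n) ^ q * V))"
        using V by (intro ennreal_mult[symmetric]) auto
      finally show ?thesis by (simp add: mult_ac)
    qed
    finally show ?thesis .
  qed
  have "(\<integral>\<^sup>+ z. ennreal (?w z) \<partial>\<nu>) \<le> (\<integral>\<^sup>+ z. (\<Sum>n. ennreal (1 / (1 + real n) ^ (q + 3)) * indicator (?S n) z) \<partial>\<nu>)"
    by (intro nn_integral_mono pt)
  also have "\<dots> = (\<Sum>n. \<integral>\<^sup>+ z. ennreal (1 / (1 + real n) ^ (q + 3)) * indicator (?S n) z \<partial>\<nu>)"
    by (intro nn_integral_suminf borel_measurable_times_ennreal borel_measurable_const
        borel_measurable_indicator Smeas)
  also have "\<dots> = (\<Sum>n. ennreal (1 / (1 + real n) ^ (q + 3)) * emeasure \<nu> (?S n))"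
    using Smeas by (simp add: nn_integral_cmult_indicator)
  also have "\<dots> \<le> (\<Sum>n. ennreal (1 / (1 + real n) ^ 2 * V))"
  proof (rule suminf_le)
    fix n
    have "ennreal (1 / (1 + real n) ^ (q + 3)) * emeasure \<nu> (?S n) \<le>
      ennreal (1 / (1 + real n) ^ (q + 3)) * ennreal ((1 + real n) ^ (q + 1) * V)"
      by (intro mult_left_mono S) auto
    also have "\<dots> = ennreal (1 / (1 + real n) ^ (q + 3) * ((1 + real n) ^ (q + 1) * V))"
      using V by (intro ennreal_mult[symmetric]) auto
    also have "1 / (1 + real n) ^ (q + 3) * ((1 + real n) ^ (q + 1) * V) = 1 / (1 + real n) ^ 2 * V"
      by (simp add: power_add power2_eq_square power3_eq_cube divide_simps)
    finally show "ennreal (1 / (1 + real n) ^ (q + 3)) * emeasure \<nu> (?S n) \<le> ennreal (1 / (1 + real n) ^ 2 * V)" .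
  qed (auto intro: summableI)
  also have "\<dots> = ennreal (\<Sum>n. 1 / (1 + real n) ^ 2 * V)"
    using V inverse_squares_summable by (intro suminf_ennreal2 summable_mult2) auto
  also have "(\<Sum>n. 1 / (1 + real n) ^ 2 * V) = (\<Sum>n. 1 / (1 + real n) ^ 2) * V"
    by (rule suminf_mult2[symmetric, OF inverse_squares_summable])
  finally have nn: "(\<integral>\<^sup>+ z. ennreal (?w z) \<partial>\<nu>) \<le> ennreal ((\<Sum>n. 1 / (1 + real n) ^ 2) * V)" .
  then show ?int
    using meas wnn by (intro integrableI_bounded) (auto simp: abs_of_nonneg intro: le_less_trans)
  have "(\<Sum>n. 1 / (1 + real n) ^ 2) \<ge> 0"
    by (intro suminf_nonneg inverse_squares_summable) auto
  then show ?le
    using nn meas V unfolding V_def[symmetric] by (intro integral_real_bounded) auto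
qed

text \<open>The constant 2A is fixed by a -> A + a/2, while the coefficient of the polynomial part
  is halved in every round. Hence \<open>rec\<close> has to hold for all \<open>\<alpha>\<close> and
  \<open>\<beta>\<close>, and the limit is taken with \<open>s\<close> fixed.\<close>

lemma window_bounded_by_recursion:
  fixes \<nu> :: "complex measure"
  assumes A: "A \<ge> 0" "\<beta> \<ge> 0" "L > 0"
    and h0: "\<And>s. emeasure \<nu> {z. \<bar>Re z - s\<bar> \<le> L} \<le> ennreal (\<beta> * (1 + \<bar>s\<bar> / L) ^ q)"
    and rec: "\<And>\<alpha> \<beta> s. \<alpha> \<ge> 0 \<Longrightarrow> \<beta> \<ge> 0 \<Longrightarrow>
      (\<And>s. emeasure \<nu> {z. \<bar>Re z - s\<bar> \<le> L} \<le> ennreal (\<alpha> + \<beta> * (1 + \<bar>s\<bar> / L) ^ q)) \<Longrightarrow>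
      emeasure \<nu> {z. \<bar>Re z - s\<bar> \<le> L} \<le> ennreal (A + (\<alpha> + \<beta> * (1 + \<bar>s\<bar> / L) ^ q) / 2)"
  shows "emeasure \<nu> {z. \<bar>Re z - s\<bar> \<le> L} \<le> ennreal (2 * A)"
proof -
  have *: "emeasure \<nu> {z. \<bar>Re z - s\<bar> \<le> L} \<le> ennreal (2 * A + \<beta> / 2 ^ n * (1 + \<bar>s\<bar> / L) ^ q)" for n s
  proof (induction n arbitrary: s)
    case 0
    have "emeasure \<nu> {z. \<bar>Re z - s\<bar> \<le> L} \<le> ennreal (\<beta> * (1 + \<bar>s\<bar> / L) ^ q)" by (rule h0)
    also have "\<dots> \<le> ennreal (2 * A + \<beta> / 2 ^ 0 * (1 + \<bar>s\<bar> / L) ^ q)"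
      using A by (intro ennreal_leI) simp
    finally show ?case .
  next
    case (Suc n)
    have "emeasure \<nu> {z. \<bar>Re z - s\<bar> \<le> L} \<le> ennreal (A + (2 * A + \<beta> / 2 ^ n * (1 + \<bar>s\<bar> / L) ^ q) / 2)"
      using A by (intro rec Suc.IH) auto
    also have "A + (2 * A + \<beta> / 2 ^ n * (1 + \<bar>s\<bar> / L) ^ q) / 2 = 2 * A + \<beta> / 2 ^ Suc n * (1 + \<bar>s\<bar> / L) ^ q"
      by (simp add: field_simps)
    finally show ?case .
  qed
  have "(\<lambda>n. 2 * A + \<beta> * (1/2) ^ n * (1 + \<bar>s\<bar> / L) ^ q) \<longlonglongrightarrow> 2 * A + \<beta> * 0 * (1 + \<bar>s\<bar> / L) ^ q"
    by (intro tendsto_intros LIMSEQ_power_zero) auto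
  then have "(\<lambda>n. ennreal (2 * A + \<beta> / 2 ^ n * (1 + \<bar>s\<bar> / L) ^ q)) \<longlonglongrightarrow> ennreal (2 * A)"
    by (intro tendsto_ennrealI) (simp add: power_one_over field_simps)
  then show ?thesis
    using * by (intro LIMSEQ_le_const) auto
qed

section \<open>A test function whose transform is almost positive on the strip\<close>

text \<open>In the middle half both arguments r + x and r - x are at least r/2, so each flat factor
  is at least exp(-2/r).\<close>

lemma bump_lower_bound:
  assumes "r > 0" "\<bar>x\<bar> \<le> r / 2"
  shows "bump r x \<ge> exp (- 4 / r)"
proof -
  have "exp (- 2 / r) \<le> flat_fun 1 y" if "y \<ge> r / 2" for y
  proof -
    have "1 / y \<le> 1 / (r / 2)" using assms that by (intro divide_left_mono) auto
    then show ?thesis using assms that by (auto simp: flat_fun_def)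
  qed
  then have "exp (- 2 / r) * exp (- 2 / r) \<le> bump r x"
    unfolding bump_def using assms by (intro mult_mono) (auto simp: flat_fun_def)
  then show ?thesis by (simp flip: exp_add)
qed

text \<open>Conjugating the kernel at a real point is the substitution t -> -t, which leaves the
  even real bump unchanged.\<close>

lemma cfourier_bump_real: "Im (cfourier (\<lambda>t. complex_of_real (bump r t)) (complex_of_real x)) = 0"
proof -
  let ?f = "\<lambda>t. complex_of_real (bump r t) * exp (- (2 * pi * \<i>) * complex_of_real x * complex_of_real t)"
  have "cnj (cfourier (\<lambda>t. complex_of_real (bump r t)) (complex_of_real x)) = (LINT t|lborel. cnj (?f t))"
    unfolding cfourier_def by (rule Bochner_Integration.integral_cnj[symmetric])
  also have "\<dots> = (LINT t|lborel. ?f t)"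
    by (subst lborel_integral_real_affine[of "-1" _ 0]) (auto simp: exp_cnj)
  also have "\<dots> = cfourier (\<lambda>t. complex_of_real (bump r t)) (complex_of_real x)"
    unfolding cfourier_def ..
  finally show ?thesis
    by (metis Reals_cnj_iff complex_is_Real_iff)
qed

text \<open>Radius 1/8 keeps the phase 2 pi x t below pi/3, so the cosine stays at least 1/2 on the
  support. The constant is exp(-32), the lower bound of the bump on [-1/16, 1/16], times 1/2, times
  the length 1/8 of that interval.\<close>

lemma cfourier_bump_lower_bound:
  "\<exists>c>0. \<forall>x. \<bar>x\<bar> \<le> 1 \<longrightarrow> c \<le> Re (cfourier (\<lambda>t. complex_of_real (bump (1/8) t)) (complex_of_real x))"
proof (intro exI conjI allI impI)
  let ?c = "exp (- 32) / 2 * (1 / 8) :: real"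
  show "?c > 0" by simp
  fix x :: real assume x: "\<bar>x\<bar> \<le> 1"
  let ?f = "\<lambda>t. complex_of_real (bump (1/8) t) * exp (- (2 * pi * \<i>) * complex_of_real x * complex_of_real t)"
  have int: "integrable lborel ?f"
    by (intro integrable_test_fun_mult test_fun_bump continuous_intros)
  have Re_f: "Re (?f t) = bump (1/8) t * cos (2 * pi * x * t)" for t
    by (simp add: Re_exp)
  have "?c = (LINT t|lborel. exp (- 32) / 2 * indicator {-1/16..1/16::real} t)"
    by simp
  also have "\<dots> \<le> (LINT t|lborel. Re (?f t))"
  proof (rule integral_mono)
    show "integrable lborel (\<lambda>t. exp (- 32) / 2 * indicator {-1/16..1/16::real} t :: real)"
      by simp
    show "integrable lborel (\<lambda>t. Re (?f t))" using int by (rule integrable_Re)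
    fix t :: real
    have cos: "cos (2 * pi * x * t) \<ge> 1 / 2" if "\<bar>t\<bar> < 1/8"
    proof -
      have "\<bar>x * t\<bar> \<le> 1 * (1/8)"
        unfolding abs_mult using x that by (intro mult_mono) auto
      then have "\<bar>2 * pi * x * t\<bar> \<le> pi / 3"
        by (simp add: abs_mult mult.assoc)
      then have "cos (pi / 3) \<le> cos \<bar>2 * pi * x * t\<bar>"
        by (intro cos_monotone_0_pi_le) auto
      then show ?thesis by (simp add: cos_60)
    qed
    show "exp (- 32) / 2 * indicator {-1/16..1/16} t \<le> Re (?f t)"
    proof (cases "\<bar>t\<bar> < 1/8")
      case True
      have "exp (- 32) * indicator {-1/16..1/16} t \<le> bump (1/8) t"
        using bump_lower_bound[of "1/8" t] bump_nonneg[of "1/8" t] by (auto simp: indicator_def)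
      then have "(exp (- 32) * indicator {-1/16..1/16} t) * (1/2) \<le> bump (1/8) t * cos (2 * pi * x * t)"
        using cos[OF True] bump_nonneg by (intro mult_mono) auto
      then show ?thesis unfolding Re_f by simp
    next
      case False
      then show ?thesis unfolding Re_f by (auto simp: bump_eq_0 indicator_def)
    qed
  qed
  also have "\<dots> = Re (cfourier (\<lambda>t. complex_of_real (bump (1/8) t)) (complex_of_real x))"
    unfolding cfourier_def using int by (rule integral_Re)
  finally show "?c \<le> \<dots>" .
qed

lemma abs_exp_minus_one_le: "\<bar>exp a - 1\<bar> \<le> \<bar>a\<bar> * exp \<bar>a\<bar>" for a :: real
proof (cases "a \<ge> 0")
  case True
  have "(1 - a) * exp a \<le> exp (- a) * exp a"
    using exp_ge_add_one_self[of "- a"] by (intro mult_right_mono) auto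
  then show ?thesis using True by (simp add: algebra_simps flip: exp_add)
next
  case False
  have "- a * 1 \<le> - a * exp (- a)" using False by (intro mult_left_mono) auto
  moreover have "1 - exp a \<le> - a * 1" using exp_ge_add_one_self[of a] by linarith
  ultimately have "1 - exp a \<le> - a * exp (- a)" by linarith
  then show ?thesis using False by simp
qed

text \<open>Passing from x to x + iy multiplies the kernel by the real factor exp(2 pi y t), which
  is within O(|y|) of 1 on the support. The constant does not depend on x because the kernel at real
  points has modulus 1.\<close>

lemma cfourier_vertical_lipschitz:
  assumes "test_fun g"
  shows "\<exists>C\<ge>0. \<forall>x y. \<bar>y\<bar> \<le> 1 \<longrightarrow> norm (cfourier g (Complex x y) - cfourier g (complex_of_real x)) \<le> C * \<bar>y\<bar>"
proof -
  obtain R where R: "R > 0" "\<And>x. \<bar>x\<bar> \<ge> R \<Longrightarrow> g x = 0"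
    using assms by (meson test_fun_suppE)
  let ?K = "2 * pi * R * exp (2 * pi * R)"
  let ?C = "\<integral>t. norm (g t) * ?K \<partial>lborel"
  have intg: "integrable lborel (\<lambda>t. norm (g t))"
    using integrable_test_fun_mult[OF assms, of "\<lambda>_. 1"] by auto
  define e where "e z t = exp (- (2 * pi * \<i>) * z * complex_of_real t)" for z t
  have int: "integrable lborel (\<lambda>t. g t * e z t)" for z
    unfolding e_def by (intro integrable_test_fun_mult assms continuous_intros)
  have "norm (cfourier g (Complex x y) - cfourier g (complex_of_real x)) \<le> ?C * \<bar>y\<bar>" if y: "\<bar>y\<bar> \<le> 1" for x y
  proof -
    have pt: "norm (g t * e (Complex x y) t - g t * e (of_real x) t) \<le> norm (g t) * ?K * \<bar>y\<bar>" for t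
    proof (cases "\<bar>t\<bar> \<ge> R")
      case False
      have e: "e (Complex x y) t = e (of_real x) t * of_real (exp (2 * pi * y * t))"
        unfolding e_def Complex_eq by (simp flip: exp_of_real exp_add add: algebra_simps)
      have "\<bar>2 * pi * y * t\<bar> = 2 * pi * \<bar>t\<bar> * \<bar>y\<bar>" by (simp add: abs_mult)
      moreover have "2 * pi * \<bar>t\<bar> * \<bar>y\<bar> \<le> 2 * pi * R * \<bar>y\<bar>"
        using False by (intro mult_right_mono mult_left_mono) auto
      moreover have "2 * pi * R * \<bar>y\<bar> \<le> 2 * pi * R * 1"
        using R y by (intro mult_left_mono) auto
      ultimately have "\<bar>2 * pi * y * t\<bar> \<le> 2 * pi * R * \<bar>y\<bar>" "\<bar>2 * pi * y * t\<bar> \<le> 2 * pi * R"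
        by linarith+
      then have "\<bar>2 * pi * y * t\<bar> * exp \<bar>2 * pi * y * t\<bar> \<le> (2 * pi * R * \<bar>y\<bar>) * exp (2 * pi * R)"
        using R by (intro mult_mono iffD2[OF exp_le_cancel_iff]) auto
      then have le: "\<bar>exp (2 * pi * y * t) - 1\<bar> \<le> ?K * \<bar>y\<bar>"
        using abs_exp_minus_one_le[of "2 * pi * y * t"] by (simp add: mult_ac)
      have "g t * e (Complex x y) t - g t * e (of_real x) t = g t * (e (of_real x) t * of_real (exp (2 * pi * y * t) - 1))"
        unfolding e by (simp add: algebra_simps)
      also have "norm \<dots> = norm (g t) * \<bar>exp (2 * pi * y * t) - 1\<bar>"
        unfolding norm_mult norm_of_real e_def by simp
      also have "\<dots> \<le> norm (g t) * (?K * \<bar>y\<bar>)"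
        by (intro mult_left_mono le) auto
      finally show ?thesis by (simp add: mult.assoc)
    qed (use R in auto)
    have "cfourier g (Complex x y) - cfourier g (complex_of_real x) =
        (LINT t|lborel. g t * e (Complex x y) t - g t * e (of_real x) t)"
      using int by (simp add: cfourier_def e_def)
    also have "norm \<dots> \<le> (LINT t|lborel. norm (g t) * ?K * \<bar>y\<bar>)"
      by (intro Bochner_Integration.integral_norm_bound_integral pt Bochner_Integration.integrable_diff int integrable_mult_left intg)
    finally show ?thesis by simp
  qed
  moreover have "?C \<ge> 0" using R by simp
  ultimately show ?thesis by blast
qed

text \<open>Let a and b be the transform of the bump at z and at Re z. In a^2 = b^2 + (a - b)(a + b)
  the first term is the square of a real number, and at least c^2 on the central window; in the
  second, a - b is O(|Im z|) and a + b decays. The explicit factor |Im z| is what a dilation will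
  make small.\<close>

lemma almost_positive_kernel:
  "\<exists>\<psi> c C. test_fun \<psi> \<and> c > 0 \<and> C \<ge> 0 \<and> (\<forall>z. \<bar>Im z\<bar> \<le> 1 \<longrightarrow>
     c * indicator {-1..1} (Re z) - C * \<bar>Im z\<bar> / (1 + \<bar>Re z\<bar>) ^ n \<le> Re (cfourier \<psi> z))"
proof -
  let ?\<chi> = "\<lambda>t. complex_of_real (bump (1/8) t)"
  have \<chi>: "test_fun ?\<chi>" by (rule test_fun_bump)
  obtain c where c: "c > 0" "\<And>x. \<bar>x\<bar> \<le> 1 \<Longrightarrow> c \<le> Re (cfourier ?\<chi> (complex_of_real x))"
    using cfourier_bump_lower_bound by blast
  obtain C1 where C1: "C1 \<ge> 0" "\<And>z. \<bar>Im z\<bar> \<le> 1 \<Longrightarrow> norm (cfourier ?\<chi> z) \<le> C1 / (1 + \<bar>Re z\<bar>) ^ n"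
    using cfourier_decay[OF \<chi>, of 1 n] by blast
  obtain C2 where C2: "C2 \<ge> 0" "\<And>x y. \<bar>y\<bar> \<le> 1 \<Longrightarrow>
      norm (cfourier ?\<chi> (Complex x y) - cfourier ?\<chi> (complex_of_real x)) \<le> C2 * \<bar>y\<bar>"
    using cfourier_vertical_lipschitz[OF \<chi>] by blast
  have "c\<^sup>2 * indicator {-1..1} (Re z) - (2 * C1 * C2) * \<bar>Im z\<bar> / (1 + \<bar>Re z\<bar>) ^ n
      \<le> Re (cfourier (convolution ?\<chi> ?\<chi>) z)" if z: "\<bar>Im z\<bar> \<le> 1" for z
  proof -
    define a where "a = cfourier ?\<chi> z"
    define b where "b = cfourier ?\<chi> (complex_of_real (Re z))"
    define w where "w = (1 + \<bar>Re z\<bar>) ^ n"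
    have "norm (a - b) \<le> C2 * \<bar>Im z\<bar>"
      using C2(2)[OF z, of "Re z"] by (simp add: a_def b_def)
    moreover have "norm (a + b) \<le> C1 / w + C1 / w"
      using C1(2)[OF z] C1(2)[of "of_real (Re z)"] norm_triangle_ineq[of a b]
      by (auto simp: a_def b_def w_def)
    ultimately have "norm ((a - b) * (a + b)) \<le> (C2 * \<bar>Im z\<bar>) * (C1 / w + C1 / w)"
      unfolding norm_mult using C2(1) by (intro mult_mono) auto
    also have "\<dots> = (2 * C1 * C2) * \<bar>Im z\<bar> / w" by (simp add: field_simps)
    finally have "\<bar>Re ((a - b) * (a + b))\<bar> \<le> (2 * C1 * C2) * \<bar>Im z\<bar> / w"
      using abs_Re_le_cmod order_trans by blast
    moreover have "(a - b) * (a + b) = a * a - b * b" by (simp add: algebra_simps)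
    moreover have "Re (b * b) = (Re b)\<^sup>2"
      using cfourier_bump_real[of "1/8" "Re z"] by (simp add: b_def power2_eq_square)
    moreover have "c\<^sup>2 * indicator {-1..1} (Re z) \<le> (Re b)\<^sup>2"
      using c(1) c(2)[of "Re z"] by (auto simp: indicator_def b_def intro!: power_mono)
    moreover have "cfourier (convolution ?\<chi> ?\<chi>) z = a * a"
      by (simp add: a_def cfourier_convolution \<chi>)
    ultimately show ?thesis by (simp add: w_def)
  qed
  moreover have "c\<^sup>2 > 0" "2 * C1 * C2 \<ge> 0" using c C1 C2 by auto
  ultimately show ?thesis
    using test_fun_convolution[OF \<chi> \<chi>]
    by (intro exI[of _ "convolution ?\<chi> ?\<chi>"] exI[of _ "c\<^sup>2"] exI[of _ "2 * C1 * C2"]) auto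
qed

section \<open>Translation boundedness and independent frequencies\<close>

lemma pure_point_summable:
  assumes "cFT_pure_point \<nu> f \<Gamma> b" "test_fun g"
  shows "(\<lambda>\<gamma>. norm (b \<gamma>) * norm (g \<gamma>)) summable_on \<Gamma>"
proof -
  obtain R where R: "R > 0" "\<And>x. \<bar>x\<bar> \<ge> R \<Longrightarrow> g x = 0"
    using test_fun_suppE[OF assms(2)] by blast
  have "compact (g ` {-R..R})"
    by (intro compact_continuous_image test_fun_continuous assms) auto
  then obtain B where B: "\<And>x. x \<in> {-R..R} \<Longrightarrow> norm (g x) \<le> B"
    using compact_imp_bounded[of "g ` {-R..R}"] unfolding bounded_iff by blast
  have "(\<lambda>\<gamma>. norm (b \<gamma>)) summable_on (\<Gamma> \<inter> {-R..R})"
    using assms(1) unfolding cFT_pure_point_def by auto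
  then have "(\<lambda>\<gamma>. norm (b \<gamma>) * B) summable_on (\<Gamma> \<inter> {-R..R})"
    by (rule summable_on_cmult_left)
  then have "(\<lambda>\<gamma>. norm (b \<gamma>) * norm (g \<gamma>)) summable_on (\<Gamma> \<inter> {-R..R})"
    by (rule summable_on_comparison_test) (use B in \<open>auto intro!: mult_left_mono\<close>)
  also have "?this \<longleftrightarrow> ?thesis"
  proof (rule summable_on_cong_neutral)
    fix x assume "x \<in> \<Gamma> - \<Gamma> \<inter> {-R..R}"
    then have "g x = 0" using R(2)[of x] by auto
    then show "norm (b x) * norm (g x) = 0" by simp
  qed auto
  finally show ?thesis .
qed

lemma test_fun_modulate:
  "test_fun g \<Longrightarrow> test_fun (\<lambda>t. g t * exp (2 * pi * \<i> * s * complex_of_real t))"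
  using test_fun_smooth_mult[OF _ smooth_fun_exp[of 1 "2 * pi * \<i> * s"]] by simp

text \<open>The bound is free of \<open>s\<close>; it supplies the constant term of the recursion
  for the window masses.\<close>

lemma norm_cFT_modulated_le:
  assumes "cFT_pure_point \<nu> f \<Gamma> b" "test_fun g"
  shows "norm (cFT_meas \<nu> f (\<lambda>t. g t * exp (2 * pi * \<i> * complex_of_real s * complex_of_real t)))
    \<le> (\<Sum>\<^sub>\<infinity>\<gamma>\<in>\<Gamma>. norm (b \<gamma>) * norm (g \<gamma>))"
proof -
  let ?e = "\<lambda>t. exp (2 * pi * \<i> * complex_of_real s * complex_of_real t)"
  have "norm (?e t) = 1" for t by simp
  then have eq: "norm (b \<gamma> * (g \<gamma> * ?e \<gamma>)) = norm (b \<gamma>) * norm (g \<gamma>)" for \<gamma>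
    by (simp only: norm_mult mult_1_right)
  have "cFT_meas \<nu> f (\<lambda>t. g t * ?e t) = (\<Sum>\<^sub>\<infinity>\<gamma>\<in>\<Gamma>. b \<gamma> * (g \<gamma> * ?e \<gamma>))"
    using assms test_fun_modulate unfolding cFT_pure_point_def by blast
  also have "norm \<dots> \<le> (\<Sum>\<^sub>\<infinity>\<gamma>\<in>\<Gamma>. norm (b \<gamma> * (g \<gamma> * ?e \<gamma>)))"
    by (rule norm_infsum_bound) (use pure_point_summable[OF assms] in \<open>simp only: eq\<close>)
  finally show ?thesis by (simp only: eq)
qed

lemma positive_pure_point_imp_translation_bounded:
  fixes \<nu> :: "complex measure"
  assumes H: "H > 0" and sets: "sets \<nu> = sets borel" and f_meas: "f \<in> borel_measurable \<nu>"
    and f1: "AE z in \<nu>. f z = 1" and strip: "AE z in \<nu>. z \<in> strip H"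
    and C0: "C0 > 0" "\<rho> > 0"
    and growth: "\<And>r. r > 0 \<Longrightarrow> emeasure \<nu> {z \<in> strip H. \<bar>Re z\<bar> \<le> r} \<le> ennreal (C0 * max 1 (r powr \<rho>))"
    and pp: "cFT_pure_point \<nu> f \<Gamma> b"
  shows "\<exists>L>0. \<exists>M\<ge>0. \<forall>s. emeasure \<nu> {z. \<bar>Re z - s\<bar> \<le> L} \<le> ennreal M"
proof -
  define q where "q = nat \<lceil>\<rho>\<rceil>"
  define K where "K = (\<Sum>n. 1 / (1 + real n) ^ 2)"
  have K: "K \<ge> 0"
    unfolding K_def by (intro suminf_nonneg inverse_squares_summable) auto
  obtain \<psi> c C where \<psi>: "test_fun \<psi>" and c: "c > 0" and C: "C \<ge> 0"
    and low: "\<And>z. \<bar>Im z\<bar> \<le> 1 \<Longrightarrow>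
      c * indicator {-1..1} (Re z) - C * \<bar>Im z\<bar> / (1 + \<bar>Re z\<bar>) ^ (q + 3) \<le> Re (cfourier \<psi> z)"
    using almost_positive_kernel[of "q + 3"] by auto
  obtain C3 where C3: "C3 \<ge> 0" "\<And>z. \<bar>Im z\<bar> \<le> 1 \<Longrightarrow> norm (cfourier \<psi> z) \<le> C3 / (1 + \<bar>Re z\<bar>) ^ (q + 3)"
    using cfourier_decay[OF \<psi>, of 1 "q + 3"] by blast
  \<comment> \<open>\<open>L \<ge> 1\<close> makes |s| + L at least 1 in the growth bound,
    \<open>L \<ge> H\<close> brings the rescaled strip into |Im z| \<le> 1 where the kernel
    estimates hold, and the last bound makes the error at most half of the averaged mass.\<close>
  define L where "L = max (max 1 H) (2 * C * H * K / c)"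
  have L: "L \<ge> 1" "L \<ge> H" "L \<ge> 2 * C * H * K / c" "L > 0"
    unfolding L_def by auto
  define g0 where "g0 = (\<lambda>t. of_real L * \<psi> (L * t))"
  have g0: "test_fun g0"
    using test_fun_smooth_mult[OF test_fun_affine[OF \<psi>, of L 0] smooth_fun_exp[of "of_real L" 0]] L(4)
    by (simp add: g0_def mult.commute)
  define A where "A = (\<Sum>\<^sub>\<infinity>\<gamma>\<in>\<Gamma>. norm (b \<gamma>) * norm (g0 \<gamma>)) / c"
  have A: "A \<ge> 0" unfolding A_def using c by (intro divide_nonneg_pos infsum_nonneg) auto
  have Smeas: "{z. \<bar>Re z - s\<bar> \<le> L} \<in> sets \<nu>" for s unfolding sets by measurable
  \<comment> \<open>Comes from |s| + L \<le> (1 + L)(1 + |s|/L), after the exponent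
    \<open>\<rho>\<close> has been rounded up to \<open>q\<close>.\<close>
  define \<beta>0 where "\<beta>0 = C0 * (1 + L) ^ q"
  have "emeasure \<nu> {z. \<bar>Re z - s\<bar> \<le> L} \<le> ennreal (2 * A)" for s
  proof (rule window_bounded_by_recursion)
    fix s
    have "emeasure \<nu> {z. \<bar>Re z - s\<bar> \<le> L} \<le> emeasure \<nu> {z \<in> strip H. \<bar>Re z\<bar> \<le> \<bar>s\<bar> + L}"
    proof (rule emeasure_mono_AE)
      show "AE z in \<nu>. z \<in> {z. \<bar>Re z - s\<bar> \<le> L} \<longrightarrow> z \<in> {z \<in> strip H. \<bar>Re z\<bar> \<le> \<bar>s\<bar> + L}"
        using strip by eventually_elim auto
      show "{z \<in> strip H. \<bar>Re z\<bar> \<le> \<bar>s\<bar> + L} \<in> sets \<nu>"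
        unfolding sets strip_def mem_Collect_eq by measurable
    qed
    also have "\<dots> \<le> ennreal (C0 * max 1 ((\<bar>s\<bar> + L) powr \<rho>))"
      using L by (intro growth) auto
    also have "\<dots> \<le> ennreal (\<beta>0 * (1 + \<bar>s\<bar> / L) ^ q)"
    proof (rule ennreal_leI)
      have q: "\<rho> \<le> real q" unfolding q_def using C0 by linarith
      have "\<bar>s\<bar> + L \<le> (1 + L) * (1 + \<bar>s\<bar> / L)"
        using L(4) by (simp add: field_simps)
      moreover have "1 \<le> \<bar>s\<bar> + L" using L by simp
      ultimately have "(\<bar>s\<bar> + L) powr \<rho> \<le> ((1 + L) * (1 + \<bar>s\<bar> / L)) powr \<rho>"
        using C0 by (intro powr_mono2) auto
      also have "\<dots> \<le> ((1 + L) * (1 + \<bar>s\<bar> / L)) powr real q"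
        using q \<open>\<bar>s\<bar> + L \<le> (1 + L) * (1 + \<bar>s\<bar> / L)\<close> \<open>1 \<le> \<bar>s\<bar> + L\<close>
        by (intro powr_mono) auto
      also have "\<dots> = ((1 + L) * (1 + \<bar>s\<bar> / L)) ^ q"
        using L(4) by (intro powr_realpow mult_pos_pos add_pos_nonneg) auto
      finally have "(\<bar>s\<bar> + L) powr \<rho> \<le> (1 + L) ^ q * (1 + \<bar>s\<bar> / L) ^ q"
        by (simp add: power_mult_distrib)
      moreover have "1 \<le> (\<bar>s\<bar> + L) powr \<rho>"
        using \<open>1 \<le> \<bar>s\<bar> + L\<close> C0 by (intro ge_one_powr_ge_zero) auto
      ultimately show "C0 * max 1 ((\<bar>s\<bar> + L) powr \<rho>) \<le> \<beta>0 * (1 + \<bar>s\<bar> / L) ^ q"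
        using C0 by (simp add: \<beta>0_def mult.assoc)
    qed
    finally show "emeasure \<nu> {z. \<bar>Re z - s\<bar> \<le> L} \<le> ennreal (\<beta>0 * (1 + \<bar>s\<bar> / L) ^ q)" .
  next
    fix \<alpha> \<beta> s :: real
    assume ab: "\<alpha> \<ge> 0" "\<beta> \<ge> 0"
      and h: "\<And>s. emeasure \<nu> {z. \<bar>Re z - s\<bar> \<le> L} \<le> ennreal (\<alpha> + \<beta> * (1 + \<bar>s\<bar> / L) ^ q)"
    define V where "V = \<alpha> + \<beta> * (1 + \<bar>s\<bar> / L) ^ q"
    define S where "S = {z. \<bar>Re z - s\<bar> \<le> L}"
    define w where "w = (\<lambda>z. 1 / (1 + \<bar>Re z - s\<bar> / L) ^ (q + 3))"
    have V: "V \<ge> 0" using ab L(4) by (simp add: V_def)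
    have wnn: "w z \<ge> 0" for z using L(4) by (simp add: w_def)
    have w_int: "integrable \<nu> w"
      unfolding w_def by (rule window_bound_imp_weight_bound(1)[OF sets L(4) ab h])
    have w_le: "integral\<^sup>L \<nu> w \<le> K * V"
      unfolding w_def K_def V_def by (rule window_bound_imp_weight_bound(2)[OF sets L(4) ab h])
    have S: "S \<in> sets \<nu>" unfolding S_def by (rule Smeas)
    have S_fin: "emeasure \<nu> S < \<infinity>"
      unfolding S_def using h[of s] by (rule le_less_trans) auto
    define F where "F = (\<lambda>z. cfourier \<psi> ((z - of_real s) / of_real L) * f z)"
    have F_meas: "F \<in> borel_measurable \<nu>"
    proof -
      have "(\<lambda>z. cfourier \<psi> ((z - of_real s) / of_real L)) \<in> borel_measurable borel"
        by (rule measurable_compose[OF _ borel_measurable_cfourier[OF \<psi>]]) measurable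
      then have "(\<lambda>z. cfourier \<psi> ((z - of_real s) / of_real L)) \<in> borel_measurable \<nu>"
        unfolding measurable_cong_sets[OF sets refl] .
      then show ?thesis unfolding F_def using f_meas by (rule borel_measurable_times)
    qed
    have scaled: "Re ((z - of_real s) / of_real L) = (Re z - s) / L"
      "Im ((z - of_real s) / of_real L) = Im z / L" for z
      by simp_all
    have Im_le: "\<bar>Im z / L\<bar> \<le> H / L" "H / L \<le> 1" if "z \<in> strip H" for z
      using that L by (auto simp: strip_def divide_right_mono)
    \<comment> \<open>The current window bound is already needed here: it makes the weight
      \<open>w\<close> integrable, and \<open>w\<close> dominates the slid kernel.\<close>
    have F_int: "integrable \<nu> F"
    proof (rule Bochner_Integration.integrable_bound)
      show "integrable \<nu> (\<lambda>z. C3 * w z)" using w_int by simp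
      show "AE z in \<nu>. norm (F z) \<le> norm (C3 * w z)"
        using f1 strip
      proof eventually_elim
        fix z assume z: "f z = 1" "z \<in> strip H"
        have "norm (F z) \<le> C3 / (1 + \<bar>(Re z - s) / L\<bar>) ^ (q + 3)"
          unfolding F_def z using C3(2)[of "(z - of_real s) / of_real L"] Im_le[OF z(2)]
          unfolding scaled by simp
        also have "\<dots> = C3 * w z" using L(4) by (simp add: w_def abs_divide)
        finally show "norm (F z) \<le> norm (C3 * w z)" by simp
      qed
    qed (rule F_meas)
    \<comment> \<open>Positivity of the measure enters here: as \<open>f\<close> is 1 almost
      everywhere, a pointwise lower bound for the kernel may be integrated against
      \<open>\<nu>\<close>.\<close>
    have "c * measure \<nu> S - C * H / L * integral\<^sup>L \<nu> w = (LINT z|\<nu>. c * indicator S z - C * H / L * w z)"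
      using S S_fin w_int by simp
    also have "\<dots> \<le> (LINT z|\<nu>. Re (F z))"
    proof (rule integral_mono_AE)
      show "integrable \<nu> (\<lambda>z. c * indicator S z - C * H / L * w z)"
        using S S_fin w_int by simp
      show "integrable \<nu> (\<lambda>z. Re (F z))" using F_int by simp
      show "AE z in \<nu>. c * indicator S z - C * H / L * w z \<le> Re (F z)"
        using f1 strip
      proof eventually_elim
        fix z assume z: "f z = 1" "z \<in> strip H"
        have ind: "indicator S z = (indicator {-1..1} ((Re z - s) / L) :: real)"
          using L(4) by (auto simp: S_def indicator_def field_simps abs_le_iff)
        have "\<bar>Im z / L\<bar> * (C * w z) \<le> H / L * (C * w z)"
          using Im_le[OF z(2)] C wnn by (intro mult_right_mono) auto
        moreover have "C * \<bar>Im z / L\<bar> / (1 + \<bar>(Re z - s) / L\<bar>) ^ (q + 3) = \<bar>Im z / L\<bar> * (C * w z)"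
          using L(4) by (simp add: w_def abs_divide)
        moreover have "c * indicator {-1..1} ((Re z - s) / L) - C * \<bar>Im z / L\<bar> / (1 + \<bar>(Re z - s) / L\<bar>) ^ (q + 3)
          \<le> Re (F z)"
          unfolding F_def z using low[of "(z - of_real s) / of_real L"] Im_le[OF z(2)]
          unfolding scaled by simp
        ultimately show "c * indicator S z - C * H / L * w z \<le> Re (F z)"
          unfolding ind by (simp add: mult_ac)
      qed
    qed
    also have "\<dots> = Re (integral\<^sup>L \<nu> F)" using F_int by simp
    also have "\<dots> \<le> norm (integral\<^sup>L \<nu> F)" by (rule complex_Re_le_cmod)
    also have "integral\<^sup>L \<nu> F = cFT_meas \<nu> f (\<lambda>t. g0 t * exp (2 * pi * \<i> * complex_of_real s * complex_of_real t))"
      unfolding cFT_meas_def cfourier_modulate F_def g0_def cfourier_scale[OF L(4)] ..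
    also have "norm \<dots> \<le> c * A"
      using norm_cFT_modulated_le[OF pp g0, of s] c by (simp add: A_def)
    finally have "c * measure \<nu> S \<le> c * A + C * H / L * integral\<^sup>L \<nu> w" by simp
    also have "C * H / L * integral\<^sup>L \<nu> w \<le> C * H / L * (K * V)"
      using C H L(4) w_le by (intro mult_left_mono) auto
    \<comment> \<open>Arranged so that the third lower bound on \<open>L\<close> turns the error
      into c V / 2.\<close>
    also have "C * H / L * (K * V) = (2 * C * H * K / c) * V * (c / (2 * L))"
      using c by (simp add: field_simps)
    also have "\<dots> \<le> L * V * (c / (2 * L))"
      using L V c by (intro mult_right_mono) auto
    also have "\<dots> = c * (V / 2)" using L(4) by simp
    finally have "c * measure \<nu> S \<le> c * (A + V / 2)" by (simp add: distrib_left)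
    then have "measure \<nu> S \<le> A + V / 2" using c by simp
    then have "emeasure \<nu> S \<le> ennreal (A + V / 2)"
      using S_fin by (simp add: emeasure_eq_ennreal_measure ennreal_leI less_top)
    then show "emeasure \<nu> {z. \<bar>Re z - s\<bar> \<le> L} \<le> ennreal (A + (\<alpha> + \<beta> * (1 + \<bar>s\<bar> / L) ^ q) / 2)"
      unfolding S_def V_def .
  qed (use A L C0 in \<open>auto simp: \<beta>0_def\<close>)
  then show ?thesis using L(4) A by (intro exI[of _ L] conjI exI[of _ "2 * A"]) auto
qed

section \<open>Kronecker's theorem and series with independent frequencies\<close>

text \<open>\<open>lin_indep_int\<close> is independence in the reals viewed as a module over the
  integers; enumerating \<open>F\<close> puts it into the indexed form in which Kronecker's theorem
  is stated.\<close>

lemma kronecker_lin_indep_int: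
  assumes "finite F" "lin_indep_int F" "\<epsilon> > 0"
  shows "\<exists>s. \<forall>\<gamma>\<in>F. \<exists>h::int. \<bar>s * \<gamma> - of_int h - \<alpha> \<gamma>\<bar> < \<epsilon>"
proof -
  interpret Modules.module "(\<lambda>r. (*) (real_of_int r))"
    by (simp add: Modules.module.intro distrib_left mult.commute)
  have ind: "independent F"
    unfolding independent_explicit_module
  proof (intro allI impI)
    fix t and u :: "real \<Rightarrow> int" and v
    assume *: "finite t" "t \<subseteq> F" "(\<Sum>v\<in>t. real_of_int (u v) * v) = 0" "v \<in> t"
    then show "u v = 0" using assms(2)[unfolded lin_indep_int_def, rule_format, of t u v] by simp
  qed
  obtain \<theta> :: "nat \<Rightarrow> real" where \<theta>: "bij_betw \<theta> {..<card F} F"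
    using ex_bij_betw_nat_finite[OF assms(1)] unfolding atLeast0LessThan by blast
  obtain s h where sh: "\<And>i. i < card F \<Longrightarrow> \<bar>s * \<theta> i - of_int (h i) - \<alpha> (\<theta> i)\<bar> < \<epsilon>"
  proof (rule Kronecker_thm_1[where \<alpha> = "\<lambda>i. \<alpha> (\<theta> i)"])
    show "independent (\<theta> ` {..<card F})" unfolding bij_betw_imp_surj_on[OF \<theta>] by (rule ind)
    show "inj_on \<theta> {..<card F}" using \<theta> by (rule bij_betw_imp_inj_on)
  qed (rule assms(3), rule that)
  have "\<exists>h::int. \<bar>s * \<gamma> - of_int h - \<alpha> \<gamma>\<bar> < \<epsilon>" if "\<gamma> \<in> F" for \<gamma>
  proof -
    have "\<gamma> \<in> \<theta> ` {..<card F}"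
      unfolding bij_betw_imp_surj_on[OF \<theta>] by (rule that)
    then obtain i where "i < card F" "\<gamma> = \<theta> i" by auto
    then show ?thesis using sh[of i] by (intro exI[of _ "h i"]) simp
  qed
  then show ?thesis by (intro exI[of _ s]) simp
qed

lemma norm_exp_ii_minus_one_le: "norm (exp (\<i> * complex_of_real x) - 1) \<le> \<bar>x\<bar>"
  using dist_exp_i_1[of x] abs_sin_x_le_abs_x[of "x / 2"] by (simp add: dist_norm)

text \<open>Phases can be aligned only on a finite set F. With N the sum of the moduli over F and T
  the full sum, the terms outside F contribute at most T - N, so N \<le> B + (T - N) up to an
  arbitrary error. Thus 2N \<le> T + B for every F, and the supremum over F gives T \<le> B without
  singling out an F with small tail.\<close>

lemma sum_norm_le_sup_of_indep_frequencies:
  fixes c :: "real \<Rightarrow> complex"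
  assumes indep: "\<And>F. finite F \<Longrightarrow> F \<subseteq> \<Gamma> \<Longrightarrow> lin_indep_int F"
    and summ: "(\<lambda>\<gamma>. norm (c \<gamma>)) summable_on \<Gamma>"
    and bound: "\<And>s. norm (\<Sum>\<^sub>\<infinity>\<gamma>\<in>\<Gamma>. c \<gamma> * exp (2 * pi * \<i> * complex_of_real s * complex_of_real \<gamma>)) \<le> B"
  shows "(\<Sum>\<^sub>\<infinity>\<gamma>\<in>\<Gamma>. norm (c \<gamma>)) \<le> B"
proof -
  define T where "T = (\<Sum>\<^sub>\<infinity>\<gamma>\<in>\<Gamma>. norm (c \<gamma>))"
  have "2 * (\<Sum>\<gamma>\<in>F. norm (c \<gamma>)) \<le> T + B" if F: "finite F" "F \<subseteq> \<Gamma>" for F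
  proof (rule field_le_epsilon)
    fix e :: real assume e: "e > 0"
    define N where "N = (\<Sum>\<gamma>\<in>F. norm (c \<gamma>))"
    have N: "N \<ge> 0" unfolding N_def by (intro sum_nonneg) auto
    \<comment> \<open>The total phase error is then N e / (N + 1) \<le> e; the + 1 allows for N =
      0.\<close>
    define \<epsilon> where "\<epsilon> = e / (2 * pi * (N + 1))"
    have \<epsilon>: "\<epsilon> > 0" using e N by (simp add: \<epsilon>_def)
    \<comment> \<open>With this target the exponential nearly cancels the argument of
      \<open>c \<gamma>\<close>; the integer \<open>h\<close> disappears by periodicity.\<close>
    obtain s where s: "\<And>\<gamma>. \<gamma> \<in> F \<Longrightarrow> \<exists>h::int. \<bar>s * \<gamma> - of_int h - (- Arg (c \<gamma>) / (2 * pi))\<bar> < \<epsilon>"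
      using kronecker_lin_indep_int[OF F(1) indep[OF F] \<epsilon>, of "\<lambda>\<gamma>. - Arg (c \<gamma>) / (2 * pi)"] by blast
    define a where "a \<gamma> = c \<gamma> * exp (2 * pi * \<i> * complex_of_real s * complex_of_real \<gamma>)" for \<gamma>
    have na: "norm (a \<gamma>) = norm (c \<gamma>)" for \<gamma>
      by (simp add: a_def norm_mult)
    have a_near: "norm (a \<gamma> - norm (c \<gamma>)) \<le> norm (c \<gamma>) * (2 * pi * \<epsilon>)" if \<gamma>: "\<gamma> \<in> F" for \<gamma>
    proof -
      obtain h :: int where h: "\<bar>s * \<gamma> - of_int h - (- Arg (c \<gamma>) / (2 * pi))\<bar> < \<epsilon>"
        using s[OF \<gamma>] by blast
      define x where "x = 2 * pi * (s * \<gamma> - of_int h - (- Arg (c \<gamma>) / (2 * pi)))"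
      have x: "\<bar>x\<bar> \<le> 2 * pi * \<epsilon>" using h by (simp add: x_def abs_mult)
      have "c \<gamma> = norm (c \<gamma>) * exp (\<i> * Arg (c \<gamma>))"
        using Arg_eq[of "c \<gamma>"] by (cases "c \<gamma> = 0") auto
      then have "a \<gamma> = norm (c \<gamma>) * (exp (\<i> * Arg (c \<gamma>)) * exp (2 * pi * \<i> * complex_of_real s * complex_of_real \<gamma>))"
        unfolding a_def by (metis mult.assoc)
      also have "exp (\<i> * Arg (c \<gamma>)) * exp (2 * pi * \<i> * complex_of_real s * complex_of_real \<gamma>)
          = exp (\<i> * complex_of_real x + \<i> * (of_int h * (of_real pi * 2)))"
        unfolding exp_add[symmetric] x_def by (rule arg_cong[of _ _ exp]) (simp add: field_simps)
      also have "\<dots> = exp (\<i> * complex_of_real x)"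
        by (rule exp_plus_2pin)
      finally have "a \<gamma> - norm (c \<gamma>) = norm (c \<gamma>) * (exp (\<i> * complex_of_real x) - 1)"
        by (simp add: algebra_simps)
      then have "norm (a \<gamma> - norm (c \<gamma>)) = norm (c \<gamma>) * norm (exp (\<i> * complex_of_real x) - 1)"
        by (simp add: norm_mult)
      also have "\<dots> \<le> norm (c \<gamma>) * (2 * pi * \<epsilon>)"
        using norm_exp_ii_minus_one_le[of x] x by (intro mult_left_mono) auto
      finally show ?thesis .
    qed
    have sum_a: "(\<lambda>\<gamma>. norm (a \<gamma>)) summable_on A" if "A \<subseteq> \<Gamma>" for A
      using summable_on_subset_banach[OF summ that] by (simp add: na)
    have a_summ: "a summable_on A" if "A \<subseteq> \<Gamma>" for A
      using abs_summable_summable[OF sum_a[OF that]] .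
    have split: "infsum a \<Gamma> = sum a F + infsum a (\<Gamma> - F)"
      using infsum_Un_disjoint[of a F "\<Gamma> - F"] a_summ F by (simp add: Un_absorb1 infsum_finite)
    have splitT: "T = N + (\<Sum>\<^sub>\<infinity>\<gamma>\<in>\<Gamma> - F. norm (c \<gamma>))"
      unfolding T_def N_def
      using infsum_Un_disjoint[of "\<lambda>\<gamma>. norm (c \<gamma>)" F "\<Gamma> - F"] summable_on_subset_banach[OF summ] F
      by (simp add: Un_absorb1 infsum_finite)
    have "norm (sum a F) \<le> norm (infsum a \<Gamma>) + norm (infsum a (\<Gamma> - F))"
      using norm_triangle_ineq4[of "infsum a \<Gamma>" "infsum a (\<Gamma> - F)"] split by simp
    also have "norm (infsum a \<Gamma>) \<le> B" using bound[of s] unfolding a_def .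
    also have "norm (infsum a (\<Gamma> - F)) \<le> (\<Sum>\<^sub>\<infinity>\<gamma>\<in>\<Gamma> - F. norm (a \<gamma>))"
      by (intro norm_infsum_bound sum_a) auto
    also have "\<dots> = T - N" using splitT by (simp add: na)
    finally have 1: "norm (sum a F) \<le> B + (T - N)" by simp
    have "sum a F - of_real N = (\<Sum>\<gamma>\<in>F. a \<gamma> - norm (c \<gamma>))"
      by (simp add: sum_subtractf N_def)
    also have "norm \<dots> \<le> (\<Sum>\<gamma>\<in>F. norm (c \<gamma>) * (2 * pi * \<epsilon>))"
      by (intro sum_norm_le a_near)
    also have "\<dots> = N * (2 * pi * \<epsilon>)" by (simp add: N_def sum_distrib_right)
    also have "2 * pi * \<epsilon> = e / (N + 1)" by (simp add: \<epsilon>_def)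
    also have "N * (e / (N + 1)) = e * (N / (N + 1))" by simp
    also have "\<dots> \<le> e * 1" using N e by (intro mult_left_mono) auto
    finally have "norm (sum a F - of_real N) \<le> e" by simp
    then have "N \<le> norm (sum a F) + e"
      using norm_triangle_ineq3[of "sum a F" "of_real N"] N by simp
    then show "2 * (\<Sum>\<gamma>\<in>F. norm (c \<gamma>)) \<le> T + B + e"
      using 1 unfolding N_def[symmetric] by linarith
  qed
  then have "(\<Sum>\<gamma>\<in>F. norm (c \<gamma>)) \<le> (T + B) / 2" if "finite F" "F \<subseteq> \<Gamma>" for F
    using that by fastforce
  then have "T \<le> (T + B) / 2"
    unfolding T_def by (intro infsum_le_finite_sums summ) auto
  then show ?thesis by (simp add: T_def)
qed

section \<open>Growth of the variation\<close>

text \<open>A bump of radius \<eta>/2 sees only frequencies of one independent window, and it is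
  bounded below on its middle half; this is the origin of the radius \<eta>/4.\<close>

lemma translation_bounded_imp_local_variation_bound:
  fixes \<nu> :: "complex measure"
  assumes sets: "sets \<nu> = sets borel"
    and f_unit: "AE z in \<nu>. norm (f z) = 1" and strip: "AE z in \<nu>. z \<in> strip H"
    and L: "L > 0" and M: "M \<ge> 0" "\<And>s. emeasure \<nu> {z. \<bar>Re z - s\<bar> \<le> L} \<le> ennreal M"
    and pp: "cFT_pure_point \<nu> f \<Gamma> b"
    and \<eta>: "\<eta> > 0" "\<And>t. lin_indep_int (\<Gamma> \<inter> {t - \<eta><..<t + \<eta>})"
  shows "\<exists>C. \<forall>t. pp_var \<Gamma> b {t - \<eta> / 4..t + \<eta> / 4} \<le> C * exp (2 * pi * H * \<bar>t\<bar>)"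
proof -
  define r where "r = \<eta> / 2"
  have r: "r > 0" "r < \<eta>" using \<eta> by (auto simp: r_def)
  define \<phi> where "\<phi> = (\<lambda>t. complex_of_real (bump r t))"
  have \<phi>: "test_fun \<phi>" unfolding \<phi>_def by (rule test_fun_bump)
  obtain C3 where C3: "C3 \<ge> 0" "\<And>z. \<bar>Im z\<bar> \<le> H \<Longrightarrow> norm (cfourier \<phi> z) \<le> C3 / (1 + \<bar>Re z\<bar>) ^ 3"
    using cfourier_decay[OF \<phi>, of H 3] by blast
  \<comment> \<open>Since 1 + x/L \<le> D(1 + x) for x \<ge> 0, this converts decay at unit scale
    into decay at the scale of the windows.\<close>
  define D where "D = max 1 (1 / L)"
  define K where "K = (\<Sum>n. 1 / (1 + real n) ^ 2)"
  define C where "C = C3 * D ^ 3 * (K * M)"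
  define w where "w = (\<lambda>s z. 1 / (1 + \<bar>Re z - s\<bar> / L) ^ 3)"
  have w_int: "integrable \<nu> (w s)" for s
    using window_bound_imp_weight_bound(1)[OF sets L M(1) order_refl, of 0] M(2) by (simp add: w_def)
  have w_le: "integral\<^sup>L \<nu> (w s) \<le> K * M" for s
    using window_bound_imp_weight_bound(2)[OF sets L M(1) order_refl, of 0] M(2) by (simp add: w_def K_def)
  have decay: "norm (cfourier \<phi> z) \<le> C3 * D ^ 3 / (1 + \<bar>Re z\<bar> / L) ^ 3" if "\<bar>Im z\<bar> \<le> H" for z
  proof -
    have "1 / L * \<bar>Re z\<bar> \<le> D * \<bar>Re z\<bar>" unfolding D_def by (intro mult_right_mono) auto
    then have "1 + \<bar>Re z\<bar> / L \<le> D * (1 + \<bar>Re z\<bar>)" by (simp add: distrib_left D_def add_mono)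
    then have "(1 + \<bar>Re z\<bar> / L) ^ 3 \<le> (D * (1 + \<bar>Re z\<bar>)) ^ 3"
      using L by (intro power_mono) auto
    then have "C3 * (1 + \<bar>Re z\<bar> / L) ^ 3 \<le> C3 * (D ^ 3 * (1 + \<bar>Re z\<bar>) ^ 3)"
      using C3(1) by (intro mult_left_mono) (auto simp: power_mult_distrib)
    moreover have "(1 + \<bar>Re z\<bar> / L) ^ 3 > 0" "(1 + \<bar>Re z\<bar>) ^ 3 > 0"
      using L by (auto intro!: zero_less_power add_pos_nonneg)
    ultimately have "C3 / (1 + \<bar>Re z\<bar>) ^ 3 \<le> C3 * D ^ 3 / (1 + \<bar>Re z\<bar> / L) ^ 3"
      by (simp add: divide_le_eq pos_le_divide_eq mult_ac)
    then show ?thesis using C3(2)[OF that] by linarith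
  qed
  have "pp_var \<Gamma> b {t - \<eta> / 4..t + \<eta> / 4} \<le> exp (4 / r) * C * exp (2 * pi * H * \<bar>t\<bar>)" for t
  proof -
    define g where "g = (\<lambda>x. \<phi> (x - t))"
    have g: "test_fun g" using test_fun_affine[OF \<phi>, of 1 "- t"] by (simp add: g_def)
    define \<Gamma>' where "\<Gamma>' = \<Gamma> \<inter> {t - \<eta><..<t + \<eta>}"
    define c where "c \<gamma> = b \<gamma> * g \<gamma>" for \<gamma>
    have g0: "g \<gamma> = 0" if "\<gamma> \<in> \<Gamma> - \<Gamma>'" for \<gamma>
      using that r bump_eq_0[of r "\<gamma> - t"] by (auto simp: g_def \<phi>_def \<Gamma>'_def)
    have summ: "(\<lambda>\<gamma>. norm (c \<gamma>)) summable_on \<Gamma>'"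
      using summable_on_subset_banach[OF pure_point_summable[OF pp g], of \<Gamma>']
      by (simp add: c_def norm_mult \<Gamma>'_def)
    have "(\<Sum>\<^sub>\<infinity>\<gamma>\<in>\<Gamma>'. norm (c \<gamma>)) \<le> C * exp (2 * pi * H * \<bar>t\<bar>)"
    proof (rule sum_norm_le_sup_of_indep_frequencies[OF _ summ])
      fix F assume "finite F" "F \<subseteq> \<Gamma>'"
      then show "lin_indep_int F"
        using \<eta>(2)[of t] unfolding lin_indep_int_def \<Gamma>'_def by (meson subset_trans)
    next
      fix s
      let ?e = "\<lambda>x. exp (2 * pi * \<i> * complex_of_real s * complex_of_real x)"
      have "(\<Sum>\<^sub>\<infinity>\<gamma>\<in>\<Gamma>'. c \<gamma> * ?e \<gamma>) = (\<Sum>\<^sub>\<infinity>\<gamma>\<in>\<Gamma>. b \<gamma> * (g \<gamma> * ?e \<gamma>))"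
      proof (rule infsum_cong_neutral)
        show "b \<gamma> * (g \<gamma> * ?e \<gamma>) = 0" if "\<gamma> \<in> \<Gamma> - \<Gamma>'" for \<gamma>
          using g0[OF that] by simp
      qed (auto simp: c_def \<Gamma>'_def)
      also have "\<dots> = cFT_meas \<nu> f (\<lambda>x. g x * ?e x)"
        using pp test_fun_modulate[OF g] unfolding cFT_pure_point_def by auto
      \<comment> \<open>Because \<open>s\<close> is real, the modulus of the exponential depends on
        Im z and \<open>t\<close> only; \<open>s\<close> merely moves the centre of the weight,
        whose integral is bounded uniformly.\<close>
      also have "\<dots> = (LINT z|\<nu>. exp (- (2 * pi * \<i>) * (z - of_real s) * complex_of_real t)
            * cfourier \<phi> (z - of_real s) * f z)" (is "_ = (LINT z|\<nu>. ?F z)")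
        unfolding cFT_meas_def cfourier_modulate g_def cfourier_translate ..
      finally have "norm (\<Sum>\<^sub>\<infinity>\<gamma>\<in>\<Gamma>'. c \<gamma> * ?e \<gamma>) \<le> (LINT z|\<nu>. norm (?F z))"
        by (simp only: integral_norm_bound)
      also have "\<dots> \<le> (LINT z|\<nu>. (exp (2 * pi * H * \<bar>t\<bar>) * (C3 * D ^ 3)) * w s z)"
      proof (rule integral_mono_AE')
        show "integrable \<nu> (\<lambda>z. (exp (2 * pi * H * \<bar>t\<bar>) * (C3 * D ^ 3)) * w s z)"
          using w_int by simp
        show "AE z in \<nu>. norm (?F z) \<le> (exp (2 * pi * H * \<bar>t\<bar>) * (C3 * D ^ 3)) * w s z"
          using f_unit strip
        proof eventually_elim
          fix z assume z: "norm (f z) = 1" "z \<in> strip H"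
          have Im: "\<bar>Im z\<bar> \<le> H" using z by (simp add: strip_def)
          have "Im z * t \<le> \<bar>Im z\<bar> * \<bar>t\<bar>" by (metis abs_ge_self abs_mult)
          also have "\<dots> \<le> H * \<bar>t\<bar>" using Im by (intro mult_right_mono) auto
          finally have 1: "norm (exp (- (2 * pi * \<i>) * (z - of_real s) * complex_of_real t)) \<le> exp (2 * pi * H * \<bar>t\<bar>)"
            unfolding norm_fourier_kernel by (simp add: mult.assoc)
          have 2: "norm (cfourier \<phi> (z - of_real s)) \<le> C3 * D ^ 3 * w s z"
            using decay[of "z - of_real s"] Im by (simp add: w_def)
          show "norm (?F z) \<le> (exp (2 * pi * H * \<bar>t\<bar>) * (C3 * D ^ 3)) * w s z"
            unfolding norm_mult z mult_1_right mult.assoc[of "exp _"]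
            by (intro mult_mono 1 2) auto
        qed
        show "AE z in \<nu>. 0 \<le> (exp (2 * pi * H * \<bar>t\<bar>) * (C3 * D ^ 3)) * w s z"
          using C3(1) L by (intro always_eventually allI mult_nonneg_nonneg) (auto simp: D_def w_def)
      qed
      also have "\<dots> = exp (2 * pi * H * \<bar>t\<bar>) * (C3 * D ^ 3) * integral\<^sup>L \<nu> (w s)" by simp
      also have "\<dots> \<le> exp (2 * pi * H * \<bar>t\<bar>) * (C3 * D ^ 3) * (K * M)"
        using C3(1) by (intro mult_left_mono w_le) (auto simp: D_def)
      finally show "norm (\<Sum>\<^sub>\<infinity>\<gamma>\<in>\<Gamma>'. c \<gamma> * ?e \<gamma>) \<le> C * exp (2 * pi * H * \<bar>t\<bar>)"
        by (simp add: C_def mult_ac)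
    qed
    then have "exp (4 / r) * (\<Sum>\<^sub>\<infinity>\<gamma>\<in>\<Gamma>'. norm (c \<gamma>)) \<le> exp (4 / r) * (C * exp (2 * pi * H * \<bar>t\<bar>))"
      by (intro mult_left_mono) auto
    \<comment> \<open>The factor exp(4/r) undoes the bump on its middle half.\<close>
    moreover have "pp_var \<Gamma> b {t - \<eta> / 4..t + \<eta> / 4} \<le> (\<Sum>\<^sub>\<infinity>\<gamma>\<in>\<Gamma>'. exp (4 / r) * norm (c \<gamma>))"
      unfolding pp_var_def
    proof (rule infsum_mono_neutral)
      show "(\<lambda>\<gamma>. norm (b \<gamma>)) summable_on \<Gamma> \<inter> {t - \<eta> / 4..t + \<eta> / 4}"
        using pp unfolding cFT_pure_point_def by auto
      show "(\<lambda>\<gamma>. exp (4 / r) * norm (c \<gamma>)) summable_on \<Gamma>'"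
        using summ by (rule summable_on_cmult_right)
      fix \<gamma> assume "\<gamma> \<in> (\<Gamma> \<inter> {t - \<eta> / 4..t + \<eta> / 4}) \<inter> \<Gamma>'"
      then have "bump r (\<gamma> - t) \<ge> exp (- 4 / r)"
        unfolding r_def Int_iff atLeastAtMost_iff by (intro bump_lower_bound) (use \<eta> in linarith)+
      then have "exp (4 / r) * exp (- 4 / r) \<le> exp (4 / r) * bump r (\<gamma> - t)"
        by (intro mult_left_mono) auto
      then have "1 \<le> exp (4 / r) * bump r (\<gamma> - t)" by (simp flip: exp_add)
      then have "norm (b \<gamma>) * 1 \<le> norm (b \<gamma>) * (exp (4 / r) * bump r (\<gamma> - t))"
        by (intro mult_left_mono) auto
      then show "norm (b \<gamma>) \<le> exp (4 / r) * norm (c \<gamma>)"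
        using bump_nonneg[of r "\<gamma> - t"] by (simp add: c_def g_def \<phi>_def norm_mult mult_ac)
    qed (use \<eta> in \<open>auto simp: \<Gamma>'_def\<close>)
    ultimately show ?thesis
      unfolding infsum_cmult_right' mult.assoc[of "exp (4 / r)" C] by linarith
  qed
  then show ?thesis by blast
qed

section \<open>From short intervals to long ones by covering\<close>

lemma pure_point_summable_bounded:
  assumes "cFT_pure_point \<nu> f \<Gamma> b" "bounded A"
  shows "(\<lambda>\<gamma>. norm (b \<gamma>)) summable_on (\<Gamma> \<inter> A)"
proof -
  have "compact (closure A)" using assms(2) by simp
  then have "(\<lambda>\<gamma>. norm (b \<gamma>)) summable_on (\<Gamma> \<inter> closure A)"
    using assms(1) unfolding cFT_pure_point_def by blast
  then show ?thesis
    by (rule summable_on_subset_banach) (use closure_subset in auto)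
qed

lemma pp_var_nonneg: "pp_var \<Gamma> b A \<ge> 0"
  unfolding pp_var_def by (intro infsum_nonneg) auto

text \<open>Boundedness guarantees summability; a divergent sum would have the default value 0, and
  monotonicity could fail.\<close>

lemma pp_var_mono:
  assumes "cFT_pure_point \<nu> f \<Gamma> b" "bounded B" "A \<subseteq> B"
  shows "pp_var \<Gamma> b A \<le> pp_var \<Gamma> b B"
  unfolding pp_var_def using bounded_subset[OF assms(2,3)] assms(2,3)
  by (intro infsum_mono2 pure_point_summable_bounded[OF assms(1)]) auto

lemma pp_var_UN_le:
  assumes pp: "cFT_pure_point \<nu> f \<Gamma> b" and "finite J" "\<And>j. j \<in> J \<Longrightarrow> bounded (A j)"
  shows "pp_var \<Gamma> b (\<Union>j\<in>J. A j) \<le> (\<Sum>j\<in>J. pp_var \<Gamma> b (A j))"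
  using assms(2,3)
proof (induction J rule: finite_induct)
  case empty
  then show ?case by (simp add: pp_var_def)
next
  case (insert j J)
  let ?U = "\<Union>j\<in>J. A j"
  have bU: "bounded ?U" "bounded (A j)" using insert by auto
  have "pp_var \<Gamma> b (A j \<union> (?U - A j)) = pp_var \<Gamma> b (A j) + pp_var \<Gamma> b (?U - A j)"
    unfolding pp_var_def Int_Un_distrib using bU
    by (intro infsum_Un_disjoint pure_point_summable_bounded[OF pp]) (auto intro: bounded_subset)
  also have "pp_var \<Gamma> b (?U - A j) \<le> pp_var \<Gamma> b ?U"
    by (intro pp_var_mono[OF pp] bU) auto
  also have "\<dots> \<le> (\<Sum>j\<in>J. pp_var \<Gamma> b (A j))" using insert by simp
  finally show ?case using insert by (simp add: Un_Diff_cancel)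
qed

text \<open>The covering intervals number at most 2\<rho>/d + 1, and their centres stay within
  \<rho> of \<open>t\<close>, which costs \<rho> in the exponent. It serves with radius 1 for the
  local bound and with \<open>t = 0\<close> for the type.\<close>

lemma pp_var_interval_bound:
  assumes pp: "cFT_pure_point \<nu> f \<Gamma> b" and d: "d > 0" and H: "H \<ge> 0" and C: "C \<ge> 0"
    and loc: "\<And>t. pp_var \<Gamma> b {t - d..t + d} \<le> C * exp (2 * pi * H * \<bar>t\<bar>)" and \<rho>: "\<rho> \<ge> 0"
  shows "pp_var \<Gamma> b {t - \<rho><..<t + \<rho>} \<le> (2 * \<rho> / d + 1) * C * exp (2 * pi * H * (\<bar>t\<bar> + \<rho>))"
proof -
  define n where "n = nat \<lfloor>2 * \<rho> / d\<rfloor>"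
  define \<tau> where "\<tau> j = t - \<rho> + real j * d" for j
  have n: "real n \<le> 2 * \<rho> / d" using \<rho> d by (simp add: n_def)
  have "{t - \<rho><..<t + \<rho>} \<subseteq> (\<Union>j\<in>{..n}. {\<tau> j - d..\<tau> j + d})"
  proof
    fix x assume x: "x \<in> {t - \<rho><..<t + \<rho>}"
    define j where "j = nat \<lfloor>(x - t + \<rho>) / d\<rfloor>"
    have y: "0 \<le> (x - t + \<rho>) / d" "(x - t + \<rho>) / d \<le> 2 * \<rho> / d"
      using x d by (auto intro!: divide_right_mono)
    have "j \<le> n" unfolding j_def n_def using y by (intro nat_mono floor_mono)
    moreover have "real j \<le> (x - t + \<rho>) / d" "(x - t + \<rho>) / d \<le> real j + 1"
      unfolding j_def using y by linarith+
    then have "real j * d \<le> x - t + \<rho>" "x - t + \<rho> \<le> real j * d + d"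
      using d by (auto simp: field_simps)
    then have "x \<in> {\<tau> j - d..\<tau> j + d}" using d by (auto simp: \<tau>_def)
    ultimately show "x \<in> (\<Union>j\<in>{..n}. {\<tau> j - d..\<tau> j + d})" by blast
  qed
  then have "pp_var \<Gamma> b {t - \<rho><..<t + \<rho>} \<le> pp_var \<Gamma> b (\<Union>j\<in>{..n}. {\<tau> j - d..\<tau> j + d})"
    by (intro pp_var_mono[OF pp]) auto
  also have "\<dots> \<le> (\<Sum>j\<le>n. pp_var \<Gamma> b {\<tau> j - d..\<tau> j + d})"
    by (intro pp_var_UN_le[OF pp]) auto
  also have "\<dots> \<le> (\<Sum>j\<le>n. C * exp (2 * pi * H * (\<bar>t\<bar> + \<rho>)))"
  proof (rule sum_mono)
    fix j assume j: "j \<in> {..n}"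
    have "real j * d \<le> 2 * \<rho> / d * d" using j n d by (intro mult_right_mono) auto
    then have "real j * d \<le> 2 * \<rho>" "real j * d \<ge> 0" using d by auto
    then have "\<bar>\<tau> j\<bar> \<le> \<bar>t\<bar> + \<rho>" unfolding \<tau>_def by linarith
    then have "C * exp (2 * pi * H * \<bar>\<tau> j\<bar>) \<le> C * exp (2 * pi * H * (\<bar>t\<bar> + \<rho>))"
      using H C by (intro mult_left_mono iffD2[OF exp_le_cancel_iff]) auto
    then show "pp_var \<Gamma> b {\<tau> j - d..\<tau> j + d} \<le> C * exp (2 * pi * H * (\<bar>t\<bar> + \<rho>))"
      using loc[of "\<tau> j"] by linarith
  qed
  also have "\<dots> = (real n + 1) * (C * exp (2 * pi * H * (\<bar>t\<bar> + \<rho>)))" by (simp add: algebra_simps)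
  also have "\<dots> \<le> (2 * \<rho> / d + 1) * (C * exp (2 * pi * H * (\<bar>t\<bar> + \<rho>)))"
    using n C by (intro mult_right_mono) auto
  finally show ?thesis by (simp add: mult.assoc)
qed

theorem theorem3:
  fixes H :: real and \<nu> :: "complex measure" and f :: "complex \<Rightarrow> complex"
    and \<Gamma> :: "real set" and b :: "real \<Rightarrow> complex"
  assumes H: "H > 0"
    and sets_nu: "sets \<nu> = sets borel"
    and f_meas: "f \<in> borel_measurable \<nu>"
    and f_unit: "AE z in \<nu>. norm (f z) = 1"
    and supp: "emeasure \<nu> (- strip H) = 0"
    and cases:
      "(\<exists>C0 \<rho>. C0 > 0 \<and> \<rho> > 0 \<and> (AE z in \<nu>. f z = 1) \<and>
          (\<forall>r>0. emeasure \<nu> {z \<in> strip H. \<bar>Re z\<bar> \<le> r} \<le> ennreal (C0 * max 1 (r powr \<rho>))))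
       \<or> (\<exists>M. \<forall>s. emeasure \<nu> {z \<in> strip H. s \<le> Re z \<and> Re z \<le> s + 1} \<le> ennreal M)"
    and pp: "cFT_pure_point \<nu> f \<Gamma> b"
    and indep: "\<exists>\<eta>>0. \<forall>t. lin_indep_int (\<Gamma> \<inter> {t - \<eta><..<t + \<eta>})"
  shows "(\<lambda>t. pp_var \<Gamma> b {t - 1<..<t + 1}) \<in> O[at_infinity](\<lambda>t. exp (2 * pi * H * \<bar>t\<bar>)) \<and>
         Limsup at_top (\<lambda>r. ereal (ln (pp_var \<Gamma> b {-r<..<r}) / r)) \<le> ereal (2 * pi * H)"
proof -
  have strip_meas: "strip H \<in> sets \<nu>"
    unfolding sets_nu strip_def by measurable
  have strip: "AE z in \<nu>. z \<in> strip H"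
  proof (rule AE_I')
    show "- strip H \<in> null_sets \<nu>"
      using supp strip_meas sets_nu by (intro null_setsI) auto
  qed auto
  have "\<exists>L>0. \<exists>M\<ge>0. \<forall>s. emeasure \<nu> {z. \<bar>Re z - s\<bar> \<le> L} \<le> ennreal M"
    using cases
  proof
    assume "\<exists>C0 \<rho>. C0 > 0 \<and> \<rho> > 0 \<and> (AE z in \<nu>. f z = 1) \<and>
          (\<forall>r>0. emeasure \<nu> {z \<in> strip H. \<bar>Re z\<bar> \<le> r} \<le> ennreal (C0 * max 1 (r powr \<rho>)))"
    then obtain C0 \<rho> where C0: "C0 > 0" "\<rho> > 0" "AE z in \<nu>. f z = 1"
      and growth: "\<And>r. r > 0 \<Longrightarrow> emeasure \<nu> {z \<in> strip H. \<bar>Re z\<bar> \<le> r} \<le> ennreal (C0 * max 1 (r powr \<rho>))"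
      by blast
    show ?thesis
      by (rule positive_pure_point_imp_translation_bounded[OF H sets_nu f_meas C0(3) strip C0(1,2) growth pp])
  next
    assume "\<exists>M. \<forall>s. emeasure \<nu> {z \<in> strip H. s \<le> Re z \<and> Re z \<le> s + 1} \<le> ennreal M"
    then obtain M where M: "\<And>s. emeasure \<nu> {z \<in> strip H. s \<le> Re z \<and> Re z \<le> s + 1} \<le> ennreal M"
      by blast
    \<comment> \<open>A unit segment is the window of radius 1/2 about its midpoint;
      \<open>max 0 M\<close> supplies a nonnegative real bound.\<close>
    have "emeasure \<nu> {z. \<bar>Re z - s\<bar> \<le> 1 / 2} \<le> ennreal (max 0 M)" for s
    proof -
      have "emeasure \<nu> {z. \<bar>Re z - s\<bar> \<le> 1 / 2} \<le>
          emeasure \<nu> {z \<in> strip H. s - 1 / 2 \<le> Re z \<and> Re z \<le> (s - 1 / 2) + 1}"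
      proof (rule emeasure_mono_AE)
        show "AE z in \<nu>. z \<in> {z. \<bar>Re z - s\<bar> \<le> 1 / 2} \<longrightarrow>
            z \<in> {z \<in> strip H. s - 1 / 2 \<le> Re z \<and> Re z \<le> (s - 1 / 2) + 1}"
          using strip
        proof eventually_elim
          case (elim z)
          then show ?case unfolding mem_Collect_eq by (intro impI conjI) (assumption | linarith)+
        qed
        show "{z \<in> strip H. s - 1 / 2 \<le> Re z \<and> Re z \<le> (s - 1 / 2) + 1} \<in> sets \<nu>"
          unfolding sets_nu strip_def mem_Collect_eq by measurable
      qed
      also have "\<dots> \<le> ennreal M" by (rule M)
      also have "\<dots> \<le> ennreal (max 0 M)" by (intro ennreal_leI) auto
      finally show ?thesis .
    qed
    then show ?thesis
      by (intro exI[of _ "1 / 2"] conjI exI[of _ "max 0 M"]) auto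
  qed
  then obtain L M where L: "L > 0" and M: "M \<ge> 0" "\<And>s. emeasure \<nu> {z. \<bar>Re z - s\<bar> \<le> L} \<le> ennreal M"
    by blast
  obtain \<eta> where \<eta>: "\<eta> > 0" "\<And>t. lin_indep_int (\<Gamma> \<inter> {t - \<eta><..<t + \<eta>})"
    using indep by blast
  obtain C' where C': "\<And>t. pp_var \<Gamma> b {t - \<eta> / 4..t + \<eta> / 4} \<le> C' * exp (2 * pi * H * \<bar>t\<bar>)"
    using translation_bounded_imp_local_variation_bound[OF sets_nu f_unit strip L M pp \<eta>] by blast
  \<comment> \<open>The lower bound 1 keeps the logarithm of the final estimate nonnegative.\<close>
  define C where "C = max 1 C'"
  define d where "d = \<eta> / 4"
  have d: "d > 0" and C: "C \<ge> 1" using \<eta> by (auto simp: d_def C_def)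
  have loc: "pp_var \<Gamma> b {t - d..t + d} \<le> C * exp (2 * pi * H * \<bar>t\<bar>)" for t
  proof -
    have "C' * exp (2 * pi * H * \<bar>t\<bar>) \<le> C * exp (2 * pi * H * \<bar>t\<bar>)"
      by (intro mult_right_mono) (auto simp: C_def)
    then show ?thesis using C'[of t] unfolding d_def by (rule order_trans[rotated])
  qed
  have bound: "pp_var \<Gamma> b {t - \<rho><..<t + \<rho>} \<le> (2 * \<rho> / d + 1) * C * exp (2 * pi * H * (\<bar>t\<bar> + \<rho>))"
    if "\<rho> \<ge> 0" for t \<rho>
    using pp_var_interval_bound[OF pp d _ _ loc that] H C by simp
  have "(\<lambda>t. pp_var \<Gamma> b {t - 1<..<t + 1}) \<in> O[at_infinity](\<lambda>t. exp (2 * pi * H * \<bar>t\<bar>))"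
  \<comment> \<open>The estimate holds for every \<open>t\<close>; the factor exp(2 pi H) pays for
    the radius 1 of the interval.\<close>
  proof (rule bigoI[where c = "(2 / d + 1) * C * exp (2 * pi * H)"], rule always_eventually, rule allI)
    fix t
    show "norm (pp_var \<Gamma> b {t - 1<..<t + 1}) \<le> (2 / d + 1) * C * exp (2 * pi * H) * norm (exp (2 * pi * H * \<bar>t\<bar>))"
    proof -
      have "exp (2 * pi * H * (\<bar>t\<bar> + 1)) = exp (2 * pi * H) * exp (2 * pi * H * \<bar>t\<bar>)"
        by (simp add: distrib_left flip: exp_add)
      then show ?thesis
        using bound[of 1 t] pp_var_nonneg[of \<Gamma> b "{t - 1<..<t + 1}"] by (simp add: mult.assoc)
    qed
  qed
  moreover have "Limsup at_top (\<lambda>r. ereal (ln (pp_var \<Gamma> b {-r<..<r}) / r)) \<le> ereal (2 * pi * H)"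
  proof -
    let ?G = "\<lambda>r. ln ((2 * r / d + 1) * C) / r + 2 * pi * H"
    have "\<forall>\<^sub>F r in at_top. ereal (ln (pp_var \<Gamma> b {-r<..<r}) / r) \<le> ereal (?G r)"
      using eventually_gt_at_top[of 0]
    proof eventually_elim
      case (elim r)
      define P where "P = (2 * r / d + 1) * C"
      have "1 * 1 \<le> P" unfolding P_def using elim d C by (intro mult_mono) auto
      then have P: "P \<ge> 1" by simp
      have le: "pp_var \<Gamma> b {-r<..<r} \<le> P * exp (2 * pi * H * r)"
        using bound[of r 0] elim by (simp add: P_def)
      have "ln (P * exp (2 * pi * H * r)) = ln P + 2 * pi * H * r"
        using P by (simp add: ln_mult)
      moreover have "ln (pp_var \<Gamma> b {-r<..<r}) \<le> ln (P * exp (2 * pi * H * r))"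
      \<comment> \<open>If the variation vanishes, \<open>ln 0 = 0\<close> is the value to be
        bounded, which is why P \<ge> 1 was arranged.\<close>
      proof (cases "pp_var \<Gamma> b {-r<..<r} = 0")
        case True
        have "0 \<le> ln P + 2 * pi * H * r" using P H elim by simp
        then show ?thesis using True calculation by simp
      next
        case False
        then have "pp_var \<Gamma> b {-r<..<r} > 0" using pp_var_nonneg[of \<Gamma> b "{-r<..<r}"] by linarith
        then show ?thesis using le by (intro ln_mono) auto
      qed
      ultimately have "ln (pp_var \<Gamma> b {-r<..<r}) / r \<le> (ln P + 2 * pi * H * r) / r"
        using elim by (intro divide_right_mono) auto
      also have "\<dots> = ?G r" using elim by (simp add: P_def add_divide_distrib)
      finally show ?case by simp
    qed
    then have "Limsup at_top (\<lambda>r. ereal (ln (pp_var \<Gamma> b {-r<..<r}) / r)) \<le> Limsup at_top (\<lambda>r. ereal (?G r))"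
      by (rule Limsup_mono)
    \<comment> \<open>The covering number is linear in \<open>r\<close>, so its logarithm divided by
      \<open>r\<close> tends to 0.\<close>
    also have "(?G \<longlongrightarrow> 2 * pi * H) at_top"
      using d C H by real_asymp
    then have "Limsup at_top (\<lambda>r. ereal (?G r)) = ereal (2 * pi * H)"
      by (intro lim_imp_Limsup) auto
    finally show ?thesis .
  qed
  ultimately show ?thesis by blast
qed

end
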